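(* Let $G$ be a two-layer network with connected layers $G_1$ ($n$ nodes) and $G_2$ ($m$ nodes), $n+m\ge3$, and set of admissible interlayer links $E_3$. Suppose regularity is feasible: there is a nonnegative $n\times m$ matrix $W_0$ supported on $E_3$, of total weight $1$, with constant row sums and constant column sums. Let $c^*$ be the transition threshold of the family $W=cW_0$. Then for every $0\le c\le c^*$ the maximum algebraic connectivity $F(c)=\max\{\lambda_2[L(w)] : w\ge 0,\ \sum_{\{i,j\}\in E_3}w_{ij}=c\}$ equals $$F(c)=\left(\frac1n+\frac1m\right)c,$$ it is attained with corresponding eigenvector $\begin{bmatrix} m\boldsymbol 1_n\\ -n\boldsymbol 1_m\end{bmatrix}$ (at $W=cW_0$), and it is attainable only by regular weights: every maximizer $W$ satisfies $W\boldsymbol 1_m\in\mathrm{span}\{\boldsymbol 1_n\}$ and $W^T\boldsymbol 1_n\in\mathrm{span}\{\boldsymbol 1_m\}$.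
   Context: Let $G_1=(V_1,E_1)$ and $G_2=(V_2,E_2)$ be finite undirected connected (unweighted) graphs on disjoint vertex sets with $|V_1|=n\ge1$, $|V_2|=m\ge1$, and Laplacian matrices $L_1,L_2$. Let $E_3\subseteq\{\{i,j\}:i\in V_1,j\in V_2\}$ be a set of interlayer links, with nonnegative weights $w=(w_{ij})_{\{i,j\}\in E_3}$. Let $W=[w_{ij}]$ be the $n\times m$ nonnegative matrix of interlayer weights (with $w_{ij}=0$ if $\{i,j\}\notin E_3$). The (supra-)Laplacian is $$L(w)=L(W)=\begin{bmatrix} L_1+\mathrm{diag}(W\boldsymbol 1_m) & -W\\ -W^T & L_2+\mathrm{diag}(W^T\boldsymbol 1_n)\end{bmatrix},$$ where $\boldsymbol 1_k$ is the all-ones vector in $\mathbb R^k$. Its eigenvalues, with multiplicity, are ordered $0=\lambda_1\le\lambda_2\le\lambda_3\le\cdots$; $\lambda_2$ is the algebraic connectivity. Transition threshold: if $W_0$ is a nonnegative matrix supported on $E_3$ with total weight $\boldsymbol 1_n^TW_0\boldsymbol 1_m=1$ and with constant row sums and constant column sums, then $c^*$ is the smallest $c>0$ at which the second and third smallest eigenvalues of $L(cW_0)$ coincide, $\lambda_2[L(cW_0)]=\lambda_3[L(cW_0)]$ (for small $c>0$ the second eigenvalue is $(\frac1n+\frac1m)c$, and it is simple). *)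

theory Defs
  imports "HOL-Analysis.Analysis" "HOL-Computational_Algebra.Polynomial"
begin

text \<open>
  The vertex set of a layer is a finite type, so it is nonempty and \<open>n\<close>, \<open>m\<close> are
  \<open>CARD('a)\<close>, \<open>CARD('b)\<close>. The two-layer network has the disjoint union \<open>'a + 'b\<close> as its
  vertex set.
\<close>

definition connected_graph :: "'a set set \<Rightarrow> bool" where
  "connected_graph E \<longleftrightarrow>
     (\<forall>e\<in>E. \<exists>u v. u \<noteq> v \<and> e = {u, v}) \<and>
     (\<forall>u v. (u, v) \<in> {(x, y). {x, y} \<in> E}\<^sup>*)"

definition laplacian :: "'a set set \<Rightarrow> real^'a::finite^'a" where
  "laplacian E =
     (\<chi> i j. if i = j then real (card {e \<in> E. i \<in> e}) else if {i, j} \<in> E then - 1 else 0)"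

definition diag :: "real^'a::finite \<Rightarrow> real^'a^'a" where
  "diag v = (\<chi> i j. if i = j then v $ i else 0)"

text \<open>Here \<open>1\<close> is the all-ones vector; the interlayer weight matrix is \<open>n \<times> m\<close>.\<close>

definition supra_laplacian ::
    "'a set set \<Rightarrow> 'b set set \<Rightarrow> real^'b::finite^'a::finite \<Rightarrow> real^('a + 'b)^('a + 'b)" where
  "supra_laplacian E\<^sub>1 E\<^sub>2 W = (\<chi> p q.
     case p of
       Inl i \<Rightarrow> (case q of Inl k \<Rightarrow> (laplacian E\<^sub>1 + diag (W *v 1)) $ i $ k
                       | Inr j \<Rightarrow> (- W) $ i $ j)
     | Inr j \<Rightarrow> (case q of Inl i \<Rightarrow> (- transpose W) $ j $ i
                       | Inr l \<Rightarrow> (laplacian E\<^sub>2 + diag (transpose W *v 1)) $ j $ l))"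

definition charpoly :: "real^'n::finite^'n \<Rightarrow> real poly" where
  "charpoly A = det (mat [:0, 1:] - map_matrix (\<lambda>a. [:a:]) A)"

text \<open>
  The \<open>k\<close>-th smallest eigenvalue, counted with multiplicity and starting from \<open>k = 1\<close>. It is
  meant for symmetric matrices (all of whose eigenvalues are real) and \<open>k\<close> between 1 and the
  dimension.
\<close>

definition nth_eigenvalue :: "nat \<Rightarrow> real^'n::finite^'n \<Rightarrow> real" where
  "nth_eigenvalue k A = sorted_list_of_multiset (proots (charpoly A)) ! (k - 1)"

definition is_eigenvector :: "real^'n::finite^'n \<Rightarrow> real^'n \<Rightarrow> real \<Rightarrow> bool" where
  "is_eigenvector A v l \<longleftrightarrow> v \<noteq> 0 \<and> A *v v = l *\<^sub>R v"

text \<open>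
  The link between \<open>i\<close> in the first layer and \<open>j\<close> in the second is encoded as the pair
  \<open>(i, j)\<close>, and a weight vector \<open>(w\<^sub>i\<^sub>j)\<close> indexed by the links as the matrix that
  vanishes outside of them.
\<close>

definition link_weights :: "('a \<times> 'b) set \<Rightarrow> real \<Rightarrow> (real^'b::finite^'a::finite) set" where
  "link_weights E\<^sub>3 c = {W. (\<forall>i j. 0 \<le> W $ i $ j) \<and> (\<forall>i j. (i, j) \<notin> E\<^sub>3 \<longrightarrow> W $ i $ j = 0) \<and>
     (\<Sum>(i, j)\<in>E\<^sub>3. W $ i $ j) = c}"

text \<open>Constant row sums and constant column sums.\<close>

definition regular :: "real^'b::finite^'a::finite \<Rightarrow> bool" where
  "regular W \<longleftrightarrow> W *v 1 \<in> span {1} \<and> transpose W *v 1 \<in> span {1}"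

definition algebraic_connectivity ::
    "'a set set \<Rightarrow> 'b set set \<Rightarrow> real^'b::finite^'a::finite \<Rightarrow> real" where
  "algebraic_connectivity E\<^sub>1 E\<^sub>2 W = nth_eigenvalue 2 (supra_laplacian E\<^sub>1 E\<^sub>2 W)"

definition max_algebraic_connectivity ::
    "'a::finite set set \<Rightarrow> 'b::finite set set \<Rightarrow> ('a \<times> 'b) set \<Rightarrow> real \<Rightarrow> real" where
  "max_algebraic_connectivity E\<^sub>1 E\<^sub>2 E\<^sub>3 c =
     (GREATEST l. l \<in> algebraic_connectivity E\<^sub>1 E\<^sub>2 ` link_weights E\<^sub>3 c)"

definition transition_threshold ::
    "'a set set \<Rightarrow> 'b set set \<Rightarrow> real^'b::finite^'a::finite \<Rightarrow> real" where
  "transition_threshold E\<^sub>1 E\<^sub>2 W\<^sub>0 =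
     (LEAST c. 0 < c \<and> nth_eigenvalue 2 (supra_laplacian E\<^sub>1 E\<^sub>2 (c *\<^sub>R W\<^sub>0)) =
                       nth_eigenvalue 3 (supra_laplacian E\<^sub>1 E\<^sub>2 (c *\<^sub>R W\<^sub>0)))"

end

theory Submission
  imports Defs
begin

text \<open>
  Let \<open>v\<close> be \<open>m\<close> on the first layer and \<open>- n\<close> on the second. It is orthogonal to the constants and its
  Rayleigh quotient is \<open>\<alpha> c\<close>, with \<open>\<alpha> = 1/n + 1/m\<close>, for every weight matrix of total weight \<open>c\<close>.
  So \<open>\<alpha> c\<close> bounds the second eigenvalue, and if there is equality then \<open>v\<close> minimizes the Rayleigh
  quotient over the complement of the constants, hence is an eigenvector, which says that the weights
  are regular.

  For regular weights \<open>c W\<^sub>0\<close>, \<open>v\<close> is always an eigenvector, and the other eigenvalues are those of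
  the form on the complement \<open>S\<close> of \<open>1\<close> and \<open>v\<close>. Let \<open>c\<^sub>0\<close> be the least \<open>c\<close> for which some unit vector
  of \<open>S\<close> has Rayleigh quotient at most \<open>\<alpha> c\<close>; it exists by compactness and is positive since the
  layers are connected. For \<open>0 < c < c\<^sub>0\<close> the second eigenvalue \<open>\<alpha> c\<close> is simple, and at \<open>c\<^sub>0\<close> it is multiple,
  so \<open>c\<^sub>0\<close> is the threshold.
\<close>

subsection \<open>Eigenvalues of symmetric matrices\<close>

text \<open>Near \<open>t = 0\<close> the linear term dominates: for nonzero \<open>a\<close>, the
  choice \<open>t = - a / s\<close> with \<open>s\<close> positive and above \<open>b\<close> makes
  the expression negative.\<close>

lemma zero_of_linear_le_quadratic:
  fixes a b :: real
  assumes "\<And>t. 0 \<le> 2 * t * a + t\<^sup>2 * b"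
  shows "a = 0"
proof (rule ccontr)
  assume "a \<noteq> 0"
  define s where "s = \<bar>b\<bar> + 1"
  have s: "s > 0" "b < s" by (auto simp: s_def)
  have "0 \<le> 2 * (- a / s) * a + (- a / s)\<^sup>2 * b" by (rule assms)
  also have "\<dots> = a\<^sup>2 * (b / s - 2) / s"
    using s by (simp add: power2_eq_square field_simps)
  also have "\<dots> < 0"
    using s \<open>a \<noteq> 0\<close> by (intro divide_neg_pos mult_pos_neg) (auto simp: field_simps)
  finally show False by simp
qed

lemma symmetric_matrix_inner:
  fixes A :: "real^'n^'n"
  assumes "transpose A = A"
  shows "x \<bullet> (A *v y) = (A *v x) \<bullet> y"
  by (metis assms dot_lmul_matrix vector_transpose_matrix)

lemma symmetric_form_add:
  fixes A :: "real^'n^'n"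
  assumes "transpose A = A"
  shows "(x + y) \<bullet> (A *v (x + y)) = x \<bullet> (A *v x) + 2 * (y \<bullet> (A *v x)) + y \<bullet> (A *v y)"
proof -
  have "x \<bullet> (A *v y) = y \<bullet> (A *v x)"
    using symmetric_matrix_inner[OF assms, of x y] by (simp add: inner_commute)
  then show ?thesis by (simp add: matrix_vector_right_distrib inner_add_left inner_add_right)
qed

text \<open>The quadratic form \<open>x \<bullet> (A x - a x)\<close> has a minimum at \<open>v\<close>, so its gradient there vanishes
  along \<open>S\<close>; as the gradient lies in \<open>S\<close>, it is zero.\<close>

lemma eigenvector_of_form_minimizer:
  fixes A :: "real^'n^'n"
  assumes "transpose A = A" "subspace S" "\<And>x. x \<in> S \<Longrightarrow> A *v x \<in> S"
    and min: "\<And>x. x \<in> S \<Longrightarrow> a * (x \<bullet> x) \<le> x \<bullet> (A *v x)"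
    and "v \<in> S" "v \<bullet> (A *v v) = a * (v \<bullet> v)"
  shows "A *v v = a *\<^sub>R v"
proof -
  define y where "y = A *v v - a *\<^sub>R v"
  have yS: "y \<in> S"
    unfolding y_def using assms by (simp add: subspace_diff subspace_scale)
  have "0 \<le> 2 * t * (y \<bullet> y) + t\<^sup>2 * (y \<bullet> (A *v y) - a * (y \<bullet> y))" for t
  proof -
    have "a * ((v + t *\<^sub>R y) \<bullet> (v + t *\<^sub>R y)) \<le> (v + t *\<^sub>R y) \<bullet> (A *v (v + t *\<^sub>R y))"
      using assms yS by (intro min) (simp add: subspace_add subspace_scale)
    moreover have "y \<bullet> (A *v v) = y \<bullet> y + a * (y \<bullet> v)"
      by (simp add: y_def inner_diff_right inner_diff_left)
    ultimately show ?thesis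
      using assms(6) unfolding symmetric_form_add[OF assms(1)]
      by (simp add: matrix_vector_mult_scaleR inner_add_left inner_add_right
          inner_commute[of v y] power2_eq_square algebra_simps)
  qed
  then have "y \<bullet> y = 0" by (rule zero_of_linear_le_quadratic)
  then show ?thesis by (simp add: y_def)
qed

text \<open>The form attains its minimum on the compact unit sphere of \<open>S\<close>. By
  homogeneity the minimizer meets the hypotheses of
  \<open>eigenvector_of_form_minimizer\<close>.\<close>

lemma symmetric_eigenvector_in_subspace:
  fixes A :: "real^'n^'n"
  assumes "transpose A = A" "subspace S" "\<And>x. x \<in> S \<Longrightarrow> A *v x \<in> S" "w \<in> S" "w \<noteq> 0"
  shows "\<exists>v\<in>S. norm v = 1 \<and> (\<exists>a. A *v v = a *\<^sub>R v)"
proof -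
  define K where "K = S \<inter> sphere 0 1"
  have "compact K"
    unfolding K_def by (intro closed_Int_compact closed_subspace assms compact_sphere)
  moreover have "w /\<^sub>R norm w \<in> K"
    using assms by (simp add: K_def subspace_scale)
  moreover have "continuous_on K (\<lambda>x. x \<bullet> (A *v x))"
    by (intro continuous_intros linear_continuous_on linear_linear matrix_vector_mul_linear)
      (simp add: linear_linear)
  ultimately obtain v where v: "v \<in> K" "\<And>x. x \<in> K \<Longrightarrow> v \<bullet> (A *v v) \<le> x \<bullet> (A *v x)"
    using continuous_attains_inf[of K "\<lambda>x. x \<bullet> (A *v x)"] by blast
  have vS: "v \<in> S" "norm v = 1" using v(1) by (auto simp: K_def)
  have "(v \<bullet> (A *v v)) * (x \<bullet> x) \<le> x \<bullet> (A *v x)" if "x \<in> S" for x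
  proof (cases "x = 0")
    case False
    then have "x /\<^sub>R norm x \<in> K"
      using that assms by (simp add: K_def subspace_scale)
    from v(2)[OF this] have "v \<bullet> (A *v v) \<le> (x \<bullet> (A *v x)) / (norm x)\<^sup>2"
      by (simp add: matrix_vector_mult_scaleR power2_eq_square field_simps)
    then show ?thesis
      using False by (simp add: power2_norm_eq_inner field_simps)
  qed simp
  then have "A *v v = (v \<bullet> (A *v v)) *\<^sub>R v"
    using vS by (intro eigenvector_of_form_minimizer[OF assms(1-3)]) (auto simp: dot_square_norm)
  then show ?thesis using vS by blast
qed

text \<open>Spectral theorem. An orthonormal set of eigenvectors of maximal size spans: its
  orthogonal complement is invariant under \<open>A\<close>, so if it were nonzero it would contain
  a further unit eigenvector.\<close>

theorem symmetric_matrix_orthonormal_eigenbasis: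
  fixes A :: "real^'n^'n"
  assumes "transpose A = A"
  shows "\<exists>(f :: 'n \<Rightarrow> real^'n) d. (\<forall>i j. f i \<bullet> f j = (if i = j then 1 else 0)) \<and>
    (\<forall>i. A *v f i = d i *\<^sub>R f i)"
proof -
  define P where "P B \<longleftrightarrow> pairwise orthogonal B \<and>
    (\<forall>b\<in>B. norm b = 1 \<and> (\<exists>a. A *v b = a *\<^sub>R b))" for B
  have indep: "independent B" if "P B" for B
    using that by (intro pairwise_orthogonal_independent) (auto simp: P_def)
  have "P {}" by (simp add: P_def)
  moreover have "\<forall>B. P B \<longrightarrow> card B < CARD('n) + 1"
  proof (intro allI impI)
    fix B assume "P B"
    then have "card B \<le> dim B" using independent_bound_general[OF indep] by blast
    then show "card B < CARD('n) + 1" using dim_subset_UNIV_cart[of B] by simp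
  qed
  ultimately obtain B where B: "P B" "\<And>B'. P B' \<Longrightarrow> card B' \<le> card B"
    using ex_has_greatest_nat[of P "{}" card "CARD('n) + 1"] by blast
  have finB: "finite B" using indep[OF B(1)] by (simp add: finiteI_independent)
  define S where "S = {x. \<forall>b\<in>B. orthogonal b x}"
  have S: "subspace S"
    unfolding S_def by (auto simp: subspace_def orthogonal_clauses)
  have inv: "A *v x \<in> S" if "x \<in> S" for x
  proof -
    have "orthogonal b (A *v x)" if b: "b \<in> B" for b
    proof -
      obtain a where "A *v b = a *\<^sub>R b" using B(1) b by (auto simp: P_def)
      then show ?thesis
        using \<open>x \<in> S\<close> b by (simp add: S_def orthogonal_def symmetric_matrix_inner[OF assms])
    qed
    then show ?thesis by (simp add: S_def)
  qed
  have S0: "S \<subseteq> {0}"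
  proof (rule ccontr)
    assume "\<not> S \<subseteq> {0}"
    then obtain w where w: "w \<in> S" "w \<noteq> 0" by auto
    obtain v where v: "v \<in> S" "norm v = 1" "\<exists>a. A *v v = a *\<^sub>R v"
      using symmetric_eigenvector_in_subspace[OF assms S inv w] by metis
    have "v \<notin> B"
      using v(1,2) by (auto simp: S_def orthogonal_self)
    moreover have "P (insert v B)"
      using B(1) v by (auto simp: P_def S_def pairwise_insert orthogonal_commute)
    ultimately show False using B(2)[of "insert v B"] finB by simp
  qed
  have "span B = UNIV"
  proof -
    have "dim {y \<in> UNIV. \<forall>x\<in>span B. orthogonal x y} + dim (span B) = dim (UNIV :: (real^'n) set)"
      by (intro dim_subspace_orthogonal_to_vectors) auto
    moreover have "{y \<in> UNIV. \<forall>x\<in>span B. orthogonal x y} \<subseteq> {0}"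
      using S0 span_base unfolding S_def by blast
    then have "dim {y \<in> UNIV. \<forall>x\<in>span B. orthogonal x y} = 0" by (subst dim_eq_0)
    ultimately have "dim B = DIM(real^'n)" by (simp only: dim_span dim_UNIV add_0)
    then show ?thesis by (simp only: dim_eq_full)
  qed
  then have "card B = CARD('n)"
    using dim_eq_card[of B UNIV] indep[OF B(1)] by (simp add: dim_UNIV)
  then obtain f where f: "bij_betw f (UNIV :: 'n set) B"
    using finB finite_same_card_bij[of "UNIV :: 'n set" B] by auto
  have fB: "f i \<in> B" for i using f by (auto simp: bij_betw_def)
  have "f i \<bullet> f j = (if i = j then 1 else 0)" for i j
  proof -
    have "norm (f i) = 1" using B(1) fB by (auto simp: P_def)
    moreover have "orthogonal (f i) (f j)" if "i \<noteq> j"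
      using B(1) fB f that unfolding P_def pairwise_def bij_betw_def by (metis UNIV_I inj_onD)
    ultimately show ?thesis by (auto simp: orthogonal_def dot_square_norm)
  qed
  moreover have "\<exists>a. A *v f i = a *\<^sub>R f i" for i using B(1) fB by (auto simp: P_def)
  ultimately show ?thesis by metis
qed

text \<open>Over the polynomial ring, the matrix \<open>Q\<close> with columns \<open>f j\<close>
  satisfies (X - A) Q = Q D with \<open>D\<close> diagonal. Taking determinants and cancelling
  \<open>det Q\<close> leaves \<open>det D\<close>.\<close>

lemma charpoly_eigenbasis:
  fixes A :: "real^'n^'n" and f :: "'n \<Rightarrow> real^'n"
  assumes "\<And>i j. f i \<bullet> f j = (if i = j then 1 else 0)" "\<And>i. A *v f i = d i *\<^sub>R f i"
  shows "charpoly A = (\<Prod>i\<in>UNIV. [:- d i, 1:])"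
proof -
  define Q :: "real poly^'n^'n" where "Q = (\<chi> i j. [:f j $ i:])"
  define D :: "real poly^'n^'n" where "D = (\<chi> i j. if i = j then [:- d i, 1:] else 0)"
  \<comment> \<open>Orthonormality makes \<open>det Q\<close> nonzero, hence cancellable.\<close>
  have "transpose Q ** Q = mat 1"
  proof -
    have "(\<Sum>k\<in>UNIV. f i $ k * f j $ k) = (if i = j then 1 else 0)" for i j
      using assms(1)[of i j] by (simp add: inner_vec_def)
    then show ?thesis
      by (auto simp: vec_eq_iff matrix_matrix_mult_def transpose_def Q_def mat_def sum_to_poly
          simp flip: pCons_one)
  qed
  then have "det (transpose Q) * det Q = 1"
    by (metis det_I det_mul)
  then have "det Q \<noteq> 0" by auto
  have "(mat [:0, 1:] - map_matrix (\<lambda>a. [:a:]) A) ** Q = Q ** D"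
  proof -
    have Af: "(\<Sum>k\<in>UNIV. A $ i $ k * f j $ k) = d j * f j $ i" for i j
      using arg_cong[OF assms(2)[of j], of "\<lambda>v. v $ i"] by (simp add: matrix_vector_mult_def)
    have "(\<Sum>k\<in>UNIV. ((if i = k then [:0, 1:] else 0) - [:A $ i $ k:]) * [:f j $ k:])
        = [:0, 1:] * [:f j $ i:] - [:\<Sum>k\<in>UNIV. A $ i $ k * f j $ k:]" for i j
      by (simp add: smult_diff_right sum_subtractf if_distrib[of "smult _"] sum_to_poly
          mult.commute cong: if_cong)
    moreover have "(\<Sum>k\<in>UNIV. [:f k $ i:] * (if k = j then [:- d k, 1:] else 0))
        = [:f j $ i:] * [:- d j, 1:]" for i j
      by (simp add: if_distrib[of "\<lambda>p. _ * p"] cong: if_cong)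
    ultimately show ?thesis
      unfolding Q_def D_def
      by (simp add: vec_eq_iff matrix_matrix_mult_def mat_def Af)
  qed
  then have "charpoly A * det Q = det Q * det D"
    unfolding charpoly_def by (metis det_mul)
  moreover have "det D = (\<Prod>i\<in>UNIV. [:- d i, 1:])"
    by (subst det_diagonal) (auto simp: D_def)
  ultimately show ?thesis using \<open>det Q \<noteq> 0\<close> by simp
qed

text \<open>This passes from \<open>nth_eigenvalue\<close>, defined through the roots of the
  characteristic polynomial, to an eigenbasis.\<close>

lemma proots_charpoly_eigenbasis:
  fixes A :: "real^'n^'n" and f :: "'n \<Rightarrow> real^'n"
  assumes "\<And>i j. f i \<bullet> f j = (if i = j then 1 else 0)" "\<And>i. A *v f i = d i *\<^sub>R f i"
  shows "proots (charpoly A) = image_mset d (mset_set UNIV)"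
proof -
  have "finite I \<Longrightarrow> proots (\<Prod>i\<in>I. [:- d i, 1:]) = image_mset d (mset_set I)" for I
  proof (induction I rule: finite_induct)
    case (insert i I)
    then have "(\<Prod>i\<in>I. [:- d i, 1:]) \<noteq> 0" by simp
    with insert show ?case by (simp add: proots_mult del: mult_pCons_left)
  qed simp
  then show ?thesis using charpoly_eigenbasis[OF assms] by simp
qed

section \<open>Sorted eigenvalues and the Courant-Fischer inequalities\<close>

lemma nth_eigenvalue_mono:
  fixes A :: "real^'n^'n"
  assumes "transpose A = A" "1 \<le> k" "k \<le> l" "l \<le> CARD('n)"
  shows "nth_eigenvalue k A \<le> nth_eigenvalue l A"
proof -
  obtain f :: "'n \<Rightarrow> real^'n" and d where fd: "\<And>i j. f i \<bullet> f j = (if i = j then 1 else 0)"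
      "\<And>i. A *v f i = d i *\<^sub>R f i"
    using symmetric_matrix_orthonormal_eigenbasis[OF assms(1)] by metis
  have "length (sorted_list_of_multiset (proots (charpoly A))) = CARD('n)"
    unfolding proots_charpoly_eigenbasis[OF fd] by (simp flip: size_mset)
  then show ?thesis
    unfolding nth_eigenvalue_def using assms
    by (intro sorted_nth_mono) auto
qed

text \<open>Sorting puts the values strictly below entry \<open>k - 1\<close> (positions count from
  0) before it and those strictly above it after it. Since both comparisons are strict, repeated
  eigenvalues cause no trouble.\<close>

lemma card_eigenvalues_below_above:
  fixes d :: "'n::finite \<Rightarrow> real"
  defines "xs \<equiv> sorted_list_of_multiset (image_mset d (mset_set UNIV))"
  assumes "1 \<le> k" "k \<le> CARD('n)"
  shows "card {i. d i < xs ! (k - 1)} < k"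
    and "card {i. xs ! (k - 1) < d i} \<le> CARD('n) - k"
proof -
  have len: "length xs = CARD('n)"
    unfolding xs_def by (simp flip: size_mset)
  have sorted: "sorted xs" by (simp add: xs_def)
  \<comment> \<open>\<open>xs\<close> is a rearrangement of the values \<open>d i\<close>, so
    counting indices \<open>i\<close> amounts to counting positions in \<open>xs\<close>.\<close>
  have *: "card {i. P (d i)} = card {j. j < CARD('n) \<and> P (xs ! j)}" for P
  proof -
    have "card {i. P (d i)} = size (filter_mset P (mset xs))"
      by (simp add: xs_def filter_mset_image_mset)
    also have "\<dots> = length (filter P xs)" by (metis mset_filter size_mset)
    finally show ?thesis by (simp add: length_filter_conv_card len)
  qed
  have "{j. j < CARD('n) \<and> xs ! j < xs ! (k - 1)} \<subseteq> {..<k - 1}"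
    using sorted_nth_mono[OF sorted] len by (fastforce simp flip: not_le)
  then have "card {j. j < CARD('n) \<and> xs ! j < xs ! (k - 1)} \<le> k - 1"
    by (metis card_lessThan card_mono finite_lessThan)
  then show "card {i. d i < xs ! (k - 1)} < k"
    using assms(2) by (simp only: *[of "\<lambda>y. y < xs ! (k - 1)"])
  have "{j. j < CARD('n) \<and> xs ! (k - 1) < xs ! j} \<subseteq> {k..<CARD('n)}"
  proof safe
    fix j assume j: "j < CARD('n)" "xs ! (k - 1) < xs ! j"
    have "k - 1 < j"
    proof (rule ccontr)
      assume "\<not> k - 1 < j"
      then have "xs ! j \<le> xs ! (k - 1)"
        using assms(2,3) len by (intro sorted_nth_mono sorted) auto
      with j show False by simp
    qed
    then show "j \<in> {k..<CARD('n)}" using j(1) by simp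
  qed
  then have "card {j. j < CARD('n) \<and> xs ! (k - 1) < xs ! j} \<le> CARD('n) - k"
    by (metis card_atLeastLessThan card_mono finite_atLeastLessThan)
  then show "card {i. xs ! (k - 1) < d i} \<le> CARD('n) - k"
    by (simp only: *[of "\<lambda>y. xs ! (k - 1) < y"])
qed

text \<open>The orthogonal complement \<open>T\<close> of \<open>B\<close> has codimension at most
  \<open>card B\<close>; as \<open>dim S\<close> exceeds this, \<open>S\<close> and \<open>T\<close>
  meet outside 0.\<close>

lemma exists_orthogonal_in_subspace:
  fixes S :: "'a::euclidean_space set"
  assumes "subspace S" "finite B" "card B < dim S"
  shows "\<exists>x\<in>S. x \<noteq> 0 \<and> (\<forall>b\<in>B. b \<bullet> x = 0)"
proof (rule ccontr)
  assume none: "\<not> ?thesis"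
  define T where "T = {y \<in> UNIV. \<forall>x\<in>span B. orthogonal x y}"
  have T: "subspace T" by (auto simp: T_def subspace_def orthogonal_clauses)
  have "dim T + dim (span B) = dim (UNIV :: 'a set)"
    unfolding T_def by (intro dim_subspace_orthogonal_to_vectors) auto
  moreover have "dim (span B) \<le> card B" using assms dim_le_card'[of B] by simp
  moreover have "dim {x + y |x y. x \<in> S \<and> y \<in> T} + dim (S \<inter> T) = dim S + dim T"
    using assms(1) T by (rule dim_sums_Int)
  moreover have "dim {x + y |x y. x \<in> S \<and> y \<in> T} \<le> dim (UNIV :: 'a set)"
    by (intro dim_subset) auto
  moreover have "S \<inter> T \<subseteq> {0}"
    using none span_base by (fastforce simp: T_def orthogonal_def)
  then have "dim (S \<inter> T) = 0" by (subst dim_eq_0)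
  ultimately show False using assms(3) by linarith
qed

text \<open>Parseval's identity: the matrix with rows \<open>f i\<close> is orthogonal, so it
  preserves inner products.\<close>

lemma inner_orthonormal_expansion:
  fixes f :: "'n::finite \<Rightarrow> real^'n"
  assumes "\<And>i j. f i \<bullet> f j = (if i = j then 1 else 0)"
  shows "x \<bullet> y = (\<Sum>i\<in>UNIV. (f i \<bullet> x) * (f i \<bullet> y))"
proof -
  define Q :: "real^'n^'n" where "Q = (\<chi> i j. f i $ j)"
  have "Q ** transpose Q = mat 1"
    using assms by (simp add: vec_eq_iff matrix_matrix_mult_def transpose_def Q_def mat_def
        inner_vec_def)
  then have "orthogonal_matrix (transpose Q)" by (simp add: orthogonal_matrix)
  then have "orthogonal_matrix Q" by simp
  then have "orthogonal_transformation ((*v) Q)"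
    by (simp add: orthogonal_transformation_matrix)
  then have "x \<bullet> y = (Q *v x) \<bullet> (Q *v y)"
    by (simp add: orthogonal_transformation_def)
  also have "\<dots> = (\<Sum>i\<in>UNIV. (f i \<bullet> x) * (f i \<bullet> y))"
    by (simp add: inner_vec_def matrix_vector_mult_def Q_def)
  finally show ?thesis .
qed

lemma form_eigenbasis_expansion:
  fixes A :: "real^'n^'n" and f :: "'n \<Rightarrow> real^'n"
  assumes "transpose A = A" "\<And>i j. f i \<bullet> f j = (if i = j then 1 else 0)"
    "\<And>i. A *v f i = d i *\<^sub>R f i"
  shows "x \<bullet> (A *v x) = (\<Sum>i\<in>UNIV. d i * (f i \<bullet> x)\<^sup>2)"
proof -
  have "f i \<bullet> (A *v x) = d i * (f i \<bullet> x)" for i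
    by (simp add: symmetric_matrix_inner[OF assms(1)] assms(3))
  then show ?thesis
    by (subst inner_orthonormal_expansion[OF assms(2)])
      (simp add: power2_eq_square algebra_simps)
qed

text \<open>One half of Courant-Fischer. Fewer than \<open>k\<close> eigenvectors of the basis have
  an eigenvalue below the \<open>k\<close>-th, so \<open>S\<close> contains a nonzero vector
  orthogonal to all of them; its expansion involves only eigenvalues that are at least the
  \<open>k\<close>-th.\<close>

lemma nth_eigenvalue_le_form:
  fixes A :: "real^'n^'n"
  assumes "transpose A = A" "subspace S" "1 \<le> k" "k \<le> dim S"
  shows "\<exists>x\<in>S. x \<noteq> 0 \<and> nth_eigenvalue k A * (x \<bullet> x) \<le> x \<bullet> (A *v x)"
proof -
  obtain f :: "'n \<Rightarrow> real^'n" and d where fd: "\<And>i j. f i \<bullet> f j = (if i = j then 1 else 0)"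
      "\<And>i. A *v f i = d i *\<^sub>R f i"
    using symmetric_matrix_orthonormal_eigenbasis[OF assms(1)] by metis
  define l where "l = nth_eigenvalue k A"
  have "k \<le> CARD('n)" using assms(4) dim_subset_UNIV_cart[of S] by simp
  then have "card {i. d i < l} < k"
    using card_eigenvalues_below_above(1)[OF assms(3)]
    by (simp add: l_def nth_eigenvalue_def proots_charpoly_eigenbasis[OF fd])
  then have "card (f ` {i. d i < l}) < dim S"
    using card_image_le[of "{i. d i < l}" f] assms(4) by simp
  then obtain x where x: "x \<in> S" "x \<noteq> 0" "\<And>i. d i < l \<Longrightarrow> f i \<bullet> x = 0"
    using exists_orthogonal_in_subspace[OF assms(2), of "f ` {i. d i < l}"] by auto
  have "l * (x \<bullet> x) = (\<Sum>i\<in>UNIV. l * (f i \<bullet> x)\<^sup>2)"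
    by (subst inner_orthonormal_expansion[OF fd(1)])
      (simp add: sum_distrib_left power2_eq_square)
  also have "\<dots> \<le> (\<Sum>i\<in>UNIV. d i * (f i \<bullet> x)\<^sup>2)"
  proof (rule sum_mono)
    fix i show "l * (f i \<bullet> x)\<^sup>2 \<le> d i * (f i \<bullet> x)\<^sup>2"
      using x(3)[of i] by (cases "d i < l") (auto intro: mult_right_mono)
  qed
  also have "\<dots> = x \<bullet> (A *v x)" by (rule form_eigenbasis_expansion[OF assms(1) fd, symmetric])
  finally show ?thesis using x by (auto simp: l_def)
qed

text \<open>The dual half: at most \<open>CARD('n) - k\<close> basis eigenvectors belong to
  eigenvalues above the \<open>k\<close>-th, and \<open>S\<close> is large enough to contain a
  nonzero vector orthogonal to them.\<close>

lemma form_le_nth_eigenvalue: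
  fixes A :: "real^'n^'n"
  assumes "transpose A = A" "subspace S" "1 \<le> k" "k \<le> CARD('n)" "CARD('n) < dim S + k"
  shows "\<exists>x\<in>S. x \<noteq> 0 \<and> x \<bullet> (A *v x) \<le> nth_eigenvalue k A * (x \<bullet> x)"
proof -
  obtain f :: "'n \<Rightarrow> real^'n" and d where fd: "\<And>i j. f i \<bullet> f j = (if i = j then 1 else 0)"
      "\<And>i. A *v f i = d i *\<^sub>R f i"
    using symmetric_matrix_orthonormal_eigenbasis[OF assms(1)] by metis
  define l where "l = nth_eigenvalue k A"
  have "card {i. l < d i} \<le> CARD('n) - k"
    using card_eigenvalues_below_above(2)[OF assms(3,4)]
    by (simp add: l_def nth_eigenvalue_def proots_charpoly_eigenbasis[OF fd])
  then have "card (f ` {i. l < d i}) < dim S"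
    using card_image_le[of "{i. l < d i}" f] assms(4,5) by simp
  then obtain x where x: "x \<in> S" "x \<noteq> 0" "\<And>i. l < d i \<Longrightarrow> f i \<bullet> x = 0"
    using exists_orthogonal_in_subspace[OF assms(2), of "f ` {i. l < d i}"] by auto
  have "x \<bullet> (A *v x) = (\<Sum>i\<in>UNIV. d i * (f i \<bullet> x)\<^sup>2)"
    by (rule form_eigenbasis_expansion[OF assms(1) fd])
  also have "\<dots> \<le> (\<Sum>i\<in>UNIV. l * (f i \<bullet> x)\<^sup>2)"
  proof (rule sum_mono)
    fix i show "d i * (f i \<bullet> x)\<^sup>2 \<le> l * (f i \<bullet> x)\<^sup>2"
      using x(3)[of i] by (cases "l < d i") (auto intro: mult_right_mono)
  qed
  also have "\<dots> = l * (x \<bullet> x)"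
    by (subst (2) inner_orthonormal_expansion[OF fd(1)])
      (simp add: sum_distrib_left power2_eq_square)
  finally show ?thesis using x by (auto simp: l_def)
qed

subsection \<open>The second and third eigenvalue given a kernel vector\<close>

lemma dim_orthogonal_pair:
  fixes u v :: "'a::euclidean_space"
  assumes "u \<noteq> 0" "v \<noteq> 0" "u \<bullet> v = 0"
  shows "dim (span {u, v}) = 2"
proof -
  have "u \<noteq> v" using assms by auto
  moreover have "independent {u, v}"
    using assms by (intro pairwise_orthogonal_independent)
      (auto simp: pairwise_def orthogonal_def inner_commute)
  ultimately show ?thesis by (simp add: dim_eq_card_independent)
qed

lemma dim_orthogonal_triple:
  fixes u v w :: "'a::euclidean_space"
  assumes "u \<noteq> 0" "v \<noteq> 0" "w \<noteq> 0" "u \<bullet> v = 0" "u \<bullet> w = 0" "v \<bullet> w = 0"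
  shows "dim (span {u, v, w}) = 3"
proof -
  have "u \<noteq> v" "u \<noteq> w" "v \<noteq> w" using assms by auto
  moreover have "independent {u, v, w}"
    using assms by (intro pairwise_orthogonal_independent)
      (auto simp: pairwise_def orthogonal_def inner_commute)
  ultimately show ?thesis by (simp add: dim_eq_card_independent)
qed

lemma mem_span_pair:
  assumes "x \<in> span {u, v}"
  shows "\<exists>s t. x = s *\<^sub>R u + t *\<^sub>R v"
proof -
  obtain s where "x - s *\<^sub>R u \<in> span {v}"
    using assms by (subst (asm) span_breakdown_eq) (erule exE)
  then obtain t where "x - s *\<^sub>R u = t *\<^sub>R v" unfolding span_singleton by (rule imageE)
  then have "x = s *\<^sub>R u + t *\<^sub>R v" by (simp add: diff_eq_eq add.commute)
  then show ?thesis by (intro exI)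
qed

lemma mem_span_triple: "x \<in> span {u, v, w} \<Longrightarrow> \<exists>r s t. x = r *\<^sub>R u + (s *\<^sub>R v + t *\<^sub>R w)"
proof -
  assume "x \<in> span {u, v, w}"
  then obtain r where r: "x - r *\<^sub>R u \<in> span {v, w}"
    by (subst (asm) span_breakdown_eq) (erule exE)
  from mem_span_pair[OF r] obtain s t where "x - r *\<^sub>R u = s *\<^sub>R v + t *\<^sub>R w" by (elim exE)
  then have "x = r *\<^sub>R u + (s *\<^sub>R v + t *\<^sub>R w)" by (simp add: diff_eq_eq add.commute)
  then show ?thesis by (intro exI)
qed

text \<open>In the application \<open>A\<close> is a supra-Laplacian and \<open>u\<close> the
  all-ones vector.\<close>

context
  fixes A :: "real^'n^'n" and u :: "real^'n"
  assumes A: "transpose A = A" and u: "u \<noteq> 0" "A *v u = 0"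
begin

lemma form_add_kernel:
  "(s *\<^sub>R u + x) \<bullet> (A *v (s *\<^sub>R u + x)) = x \<bullet> (A *v x)"
proof -
  have "u \<bullet> (A *v x) = 0" using symmetric_matrix_inner[OF A, of u x] u by simp
  then show ?thesis
    using u by (simp add: matrix_vector_right_distrib matrix_vector_mult_scaleR
        inner_add_left)
qed

text \<open>The trial space is spanned by \<open>u\<close> and \<open>v\<close>. The
  \<open>u\<close> component contributes nothing to the form, which stays within the bound because
  \<open>0 \<le> a\<close>.\<close>

lemma second_eigenvalue_le:
  assumes "v \<noteq> 0" "u \<bullet> v = 0" "v \<bullet> (A *v v) \<le> a * (v \<bullet> v)" "0 \<le> a"
  shows "nth_eigenvalue 2 A \<le> a"
proof -
  obtain x where x: "x \<in> span {u, v}" "x \<noteq> 0" "nth_eigenvalue 2 A * (x \<bullet> x) \<le> x \<bullet> (A *v x)"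
    using nth_eigenvalue_le_form[OF A, of "span {u, v}" 2]
      dim_orthogonal_pair[OF u(1) assms(1,2)] by auto
  obtain s t where st: "x = s *\<^sub>R u + t *\<^sub>R v" using mem_span_pair[OF x(1)] by blast
  have "x \<bullet> (A *v x) = t\<^sup>2 * (v \<bullet> (A *v v))"
    unfolding st form_add_kernel by (simp add: matrix_vector_mult_scaleR power2_eq_square)
  also have "\<dots> \<le> t\<^sup>2 * (a * (v \<bullet> v))" using assms(3) by (intro mult_left_mono) auto
  also have "\<dots> \<le> a * (x \<bullet> x)"
  proof -
    have "x \<bullet> x = s\<^sup>2 * (u \<bullet> u) + t\<^sup>2 * (v \<bullet> v)"
      using assms(2) by (simp add: st inner_add_left inner_add_right inner_commute[of v u]
          power2_eq_square)
    then show ?thesis using assms(4) by (simp add: algebra_simps)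
  qed
  finally have "nth_eigenvalue 2 A * (x \<bullet> x) \<le> a * (x \<bullet> x)" using x(3) by linarith
  then show ?thesis using x(2) by simp
qed

text \<open>Every nonzero vector orthogonal to \<open>u\<close> can serve as trial vector in
  \<open>second_eigenvalue_le\<close>, so the form is at least \<open>a\<close> times the squared
  norm there; \<open>v\<close> attains this minimum.\<close>

lemma second_eigenvalue_eq_imp_eigenvector:
  assumes "v \<noteq> 0" "u \<bullet> v = 0" "v \<bullet> (A *v v) = a * (v \<bullet> v)" "0 < a" "nth_eigenvalue 2 A = a"
  shows "A *v v = a *\<^sub>R v"
proof (rule eigenvector_of_form_minimizer[OF A])
  show "subspace {x. u \<bullet> x = 0}" by (rule subspace_hyperplane)
  show "A *v x \<in> {x. u \<bullet> x = 0}" for x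
    using symmetric_matrix_inner[OF A, of u x] u by simp
  show "a * (x \<bullet> x) \<le> x \<bullet> (A *v x)" if "x \<in> {x. u \<bullet> x = 0}" for x
  proof (cases "x = 0")
    case False
    \<comment> \<open>The cutoff at 0 supplies the nonnegativity demanded by
      \<open>second_eigenvalue_le\<close>; as \<open>0 < a \<le> b\<close>, the maximum is the
      quotient itself.\<close>
    define b where "b = max 0 (x \<bullet> (A *v x) / (x \<bullet> x))"
    have "nth_eigenvalue 2 A \<le> b"
      using False that by (intro second_eigenvalue_le[of x]) (auto simp: b_def max_def field_simps)
    then have "a \<le> x \<bullet> (A *v x) / (x \<bullet> x)" using assms(4,5) by (auto simp: b_def)
    then show ?thesis using False by (simp add: field_simps)
  qed simp
  show "v \<in> {x. u \<bullet> x = 0}" using assms by simp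
qed (use assms in auto)

context
  fixes v :: "real^'n" and a :: real
  assumes v: "v \<noteq> 0" "A *v v = a *\<^sub>R v" "u \<bullet> v = 0" and a: "0 \<le> a"
begin

lemma form_add_eigenvector:
  assumes "v \<bullet> x = 0"
  shows "(t *\<^sub>R v + x) \<bullet> (A *v (t *\<^sub>R v + x)) = a * (t\<^sup>2 * (v \<bullet> v)) + x \<bullet> (A *v x)"
  using assms v by (simp add: symmetric_form_add[OF A] matrix_vector_mult_scaleR
      inner_commute[of x v] power2_eq_square)

text \<open>For the upper bound, \<open>v\<close> is the trial vector. For the lower bound, the
  hyperplane orthogonal to \<open>u\<close> splits into the line of \<open>v\<close>, where the
  quotient is \<open>a\<close>, and a complement where it is at least \<open>a\<close>; there is no
  cross term because \<open>v\<close> is an eigenvector.\<close>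

lemma second_eigenvalue_eqI:
  assumes "2 \<le> CARD('n)"
    and "\<And>x. u \<bullet> x = 0 \<Longrightarrow> v \<bullet> x = 0 \<Longrightarrow> a * (x \<bullet> x) \<le> x \<bullet> (A *v x)"
  shows "nth_eigenvalue 2 A = a"
proof (rule antisym)
  show "nth_eigenvalue 2 A \<le> a"
    using v a by (intro second_eigenvalue_le[of v]) auto
  \<comment> \<open>Codimension 1 is exactly what \<open>form_le_nth_eigenvalue\<close> admits for
    \<open>k = 2\<close>.\<close>
  have "dim {x. u \<bullet> x = 0} = CARD('n) - 1" using u(1) by (simp add: dim_hyperplane)
  then obtain x where x: "u \<bullet> x = 0" "x \<noteq> 0" "x \<bullet> (A *v x) \<le> nth_eigenvalue 2 A * (x \<bullet> x)"
    using form_le_nth_eigenvalue[OF A subspace_hyperplane[of u], of 2] assms(1) by auto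
  define t y where "t = (v \<bullet> x) / (v \<bullet> v)" and "y = x - t *\<^sub>R v"
  have y: "v \<bullet> y = 0" "u \<bullet> y = 0"
    using v x by (auto simp: y_def t_def inner_diff_right)
  have xy: "x = t *\<^sub>R v + y" by (simp add: y_def)
  have "x \<bullet> x = t\<^sup>2 * (v \<bullet> v) + y \<bullet> y"
    using y by (simp add: xy inner_add_left inner_add_right inner_commute[of y v] power2_eq_square)
  then have "a * (x \<bullet> x) = a * (t\<^sup>2 * (v \<bullet> v)) + a * (y \<bullet> y)" by (simp add: algebra_simps)
  also have "\<dots> \<le> a * (t\<^sup>2 * (v \<bullet> v)) + y \<bullet> (A *v y)" using assms(2) y by simp
  also have "\<dots> = x \<bullet> (A *v x)" unfolding xy by (rule form_add_eigenvector[OF y(1), symmetric])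
  finally have "a * (x \<bullet> x) \<le> nth_eigenvalue 2 A * (x \<bullet> x)" using x(3) by linarith
  then show "a \<le> nth_eigenvalue 2 A" using x(2) by simp
qed

text \<open>On the three orthogonal directions of the trial space the quotient is 0,
  \<open>a\<close> and at most \<open>a\<close>, so with \<open>0 \<le> a\<close> it is at most
  \<open>a\<close> on a space of dimension 3.\<close>

lemma third_eigenvalue_le:
  assumes "u \<bullet> x = 0" "v \<bullet> x = 0" "x \<noteq> 0" "x \<bullet> (A *v x) \<le> a * (x \<bullet> x)"
  shows "nth_eigenvalue 3 A \<le> a"
proof -
  obtain z where z: "z \<in> span {u, v, x}" "z \<noteq> 0" "nth_eigenvalue 3 A * (z \<bullet> z) \<le> z \<bullet> (A *v z)"
    using nth_eigenvalue_le_form[OF A, of "span {u, v, x}" 3]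
      dim_orthogonal_triple[OF u(1) v(1) assms(3) v(3) assms(1,2)] by auto
  obtain r s t where rst: "z = r *\<^sub>R u + (s *\<^sub>R v + t *\<^sub>R x)" using mem_span_triple[OF z(1)] by blast
  have "z \<bullet> (A *v z) = a * (s\<^sup>2 * (v \<bullet> v)) + t\<^sup>2 * (x \<bullet> (A *v x))"
    unfolding rst form_add_kernel using assms(2)
    by (subst form_add_eigenvector) (auto simp: matrix_vector_mult_scaleR power2_eq_square)
  also have "\<dots> \<le> a * (s\<^sup>2 * (v \<bullet> v)) + t\<^sup>2 * (a * (x \<bullet> x))"
    using assms(4) by (intro add_left_mono mult_left_mono) auto
  also have "\<dots> \<le> a * (z \<bullet> z)"
  proof -
    have "z \<bullet> z = r\<^sup>2 * (u \<bullet> u) + s\<^sup>2 * (v \<bullet> v) + t\<^sup>2 * (x \<bullet> x)"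
      using assms(1,2) v(3) by (simp add: rst inner_add_left inner_add_right inner_commute[of v u]
          inner_commute[of x u] inner_commute[of x v] power2_eq_square)
    then show ?thesis using a by (simp add: algebra_simps)
  qed
  finally have "nth_eigenvalue 3 A * (z \<bullet> z) \<le> a * (z \<bullet> z)" using z(3) by linarith
  then show ?thesis using z(2) by simp
qed

end

text \<open>The complement of \<open>u\<close> and \<open>v\<close> has codimension at most 2, so it
  contains a nonzero vector whose Rayleigh quotient is at most the third eigenvalue.\<close>

lemma third_eigenvalue_gt:
  assumes "3 \<le> CARD('n)"
    and "\<And>x. u \<bullet> x = 0 \<Longrightarrow> v \<bullet> x = 0 \<Longrightarrow> x \<noteq> 0 \<Longrightarrow> a * (x \<bullet> x) < x \<bullet> (A *v x)"
  shows "a < nth_eigenvalue 3 A"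
proof -
  define S where "S = {y \<in> UNIV. \<forall>x\<in>span {u, v}. orthogonal x y}"
  have "dim S + dim (span {u, v}) = dim (UNIV :: (real^'n) set)"
    unfolding S_def by (intro dim_subspace_orthogonal_to_vectors) auto
  moreover have "dim (span {u, v}) \<le> 2"
    using dim_le_card'[of "{u, v}"] card_insert_le_m1[of 2 "{v}" u] by simp
  ultimately have "CARD('n) < dim S + 3" by simp
  moreover have "subspace S" by (auto simp: S_def subspace_def orthogonal_clauses)
  ultimately obtain x where x: "x \<in> S" "x \<noteq> 0" "x \<bullet> (A *v x) \<le> nth_eigenvalue 3 A * (x \<bullet> x)"
    using form_le_nth_eigenvalue[OF A, of S 3] assms(1) by auto
  have "u \<bullet> x = 0" "v \<bullet> x = 0"
    using x(1) by (auto simp: S_def orthogonal_def span_base)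
  then have "a * (x \<bullet> x) < nth_eigenvalue 3 A * (x \<bullet> x)" using assms(2)[OF _ _ x(2)] x(3) by (meson order.strict_trans2)
  then show ?thesis using x(2) by simp
qed

end

subsection \<open>First crossing along a pencil of quadratic forms\<close>

text \<open>In the application \<open>A\<close> is the Laplacian of the uncoupled layers,
  \<open>B\<close> the contribution of the links, and \<open>S\<close> the complement of the
  constants and of the eigenvector. The pairs of a parameter \<open>t\<close> and a unit vector of
  \<open>S\<close> on which the form is at most \<open>a * t\<close> form a closed set. On a bounded
  range of \<open>t\<close> it is compact, so a least \<open>t\<close> exists.\<close>

lemma form_pencil_first_crossing:
  fixes A B :: "real^'n^'n"
  assumes S: "subspace S" and pos: "\<And>x. x \<in> S \<Longrightarrow> x \<noteq> 0 \<Longrightarrow> 0 < x \<bullet> (A *v x)"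
    and z: "z \<in> S" "z \<bullet> (B *v z) < a * (z \<bullet> z)"
  obtains c where "0 < c"
    and "\<And>t x. 0 \<le> t \<Longrightarrow> t < c \<Longrightarrow> x \<in> S \<Longrightarrow> x \<noteq> 0 \<Longrightarrow>
      a * t * (x \<bullet> x) < x \<bullet> ((A + t *\<^sub>R B) *v x)"
    and "\<And>x. x \<in> S \<Longrightarrow> a * c * (x \<bullet> x) \<le> x \<bullet> ((A + c *\<^sub>R B) *v x)"
    and "\<exists>x\<in>S. x \<noteq> 0 \<and> x \<bullet> ((A + c *\<^sub>R B) *v x) \<le> a * c * (x \<bullet> x)"
proof -
  define q where "q x = x \<bullet> (A *v x)" for x
  \<comment> \<open>\<open>q x + t * b x\<close> is the excess of the form of
    \<open>A + t *\<^sub>R B\<close> over \<open>a * t * (x \<bullet> x)\<close>; it is affine in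
    \<open>t\<close>.\<close>
  define b where "b x = x \<bullet> (B *v x) - a * (x \<bullet> x)" for x
  have form: "x \<bullet> ((A + t *\<^sub>R B) *v x) = a * t * (x \<bullet> x) + (q x + t * b x)" for t x
    by (simp add: q_def b_def matrix_vector_mult_add_rdistrib scaleR_matrix_vector_assoc[symmetric]
        inner_add_right algebra_simps)
  have qscale: "q (r *\<^sub>R x) = r\<^sup>2 * q x" and bscale: "b (r *\<^sub>R x) = r\<^sup>2 * b x" for r x
    by (auto simp: q_def b_def matrix_vector_mult_scaleR power2_eq_square algebra_simps)
  define K where "K = S \<inter> sphere 0 1"
  have K: "compact K"
    unfolding K_def by (intro closed_Int_compact closed_subspace S compact_sphere)
  have qpos: "0 < q x" if "x \<in> K" for x
    using that pos[of x] by (cases "x = 0") (auto simp: K_def q_def)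
  have "z \<noteq> 0" using z by auto
  define w where "w = z /\<^sub>R norm z"
  have w: "w \<in> K" using z \<open>z \<noteq> 0\<close> S by (simp add: w_def K_def subspace_scale)
  have bw: "b w < 0"
    unfolding w_def bscale using z \<open>z \<noteq> 0\<close> by (auto simp: b_def intro!: mult_pos_neg)
  \<comment> \<open>Along \<open>w\<close> the excess decreases to 0 at \<open>T\<close>, so a
    crossing occurs by then and the search can be confined to the compact range from 0 to
    \<open>T\<close>.\<close>
  define T where "T = - q w / b w"
  have T: "0 < T" "q w + T * b w = 0"
    using bw qpos[OF w] by (auto simp: T_def field_simps)
  define P where "P = ({0..T} \<times> K) \<inter> {p. q (snd p) + fst p * b (snd p) \<le> 0}"
  have "closed {p :: real \<times> (real^'n). q (snd p) + fst p * b (snd p) \<le> 0}"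
    unfolding q_def b_def
    by (intro closed_Collect_le continuous_intros
        linear_continuous_on_compose[OF _ matrix_vector_mul_linear])
  then have "compact P"
    unfolding P_def using K by (intro compact_Int_closed compact_Times) auto
  moreover have "(T, w) \<in> P" using T w by (auto simp: P_def)
  ultimately obtain p where p: "p \<in> P" "\<And>p'. p' \<in> P \<Longrightarrow> fst p \<le> fst p'"
    using continuous_attains_inf[of P fst] continuous_on_fst continuous_on_id by blast
  obtain c x where cx: "p = (c, x)" by (cases p)
  have c: "0 \<le> c" "c \<le> T" "x \<in> K" "q x + c * b x \<le> 0"
    using p(1) by (auto simp: P_def cx)
  have c_pos: "0 < c" using c qpos[OF c(3)] by (cases "c = 0") auto
  have below: "0 < q y + t * b y" if "0 \<le> t" "t < c" "y \<in> K" for t y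
    using p(2)[of "(t, y)"] that c by (force simp: P_def cx)
  have at: "0 \<le> q y + c * b y" if "y \<in> K" for y
  proof (rule ccontr)
    assume neg: "\<not> 0 \<le> q y + c * b y"
    \<comment> \<open>Being \<open>q y > 0\<close> at \<open>t = 0\<close>, an excess that is
      negative at \<open>c\<close> must decrease and vanish at \<open>- q y / b y\<close>, before
      \<open>c\<close>, against \<open>below\<close>.\<close>
    then have b: "b y < 0"
      using qpos[OF that] c_pos by (smt (verit) mult_nonneg_nonneg)
    then have "- q y / b y < c" "0 \<le> - q y / b y"
      using neg qpos[OF that] by (auto simp: field_simps)
    from below[OF this(2,1) that] b show False by simp
  qed
  have scale: "\<exists>r>0. \<exists>y\<in>K. x = r *\<^sub>R y" if "x \<in> S" "x \<noteq> 0" for x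
    using that S by (intro exI[of _ "norm x"] conjI bexI[of _ "x /\<^sub>R norm x"])
      (auto simp: K_def subspace_scale)
  show ?thesis
  proof (rule that[of c])
    fix t x assume "0 \<le> t" "t < c" "x \<in> S" "x \<noteq> 0"
    moreover obtain r y where ry: "r > 0" "y \<in> K" "x = r *\<^sub>R y"
      using scale[OF \<open>x \<in> S\<close> \<open>x \<noteq> 0\<close>] by blast
    ultimately have "0 < r\<^sup>2 * (q y + t * b y)" using below by simp
    then show "a * t * (x \<bullet> x) < x \<bullet> ((A + t *\<^sub>R B) *v x)"
      unfolding form ry(3) qscale bscale by (simp add: algebra_simps)
  next
    fix x assume "x \<in> S"
    show "a * c * (x \<bullet> x) \<le> x \<bullet> ((A + c *\<^sub>R B) *v x)"
    proof (cases "x = 0")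
      case False
      then obtain r y where ry: "r > 0" "y \<in> K" "x = r *\<^sub>R y"
        using scale[OF \<open>x \<in> S\<close>] by blast
      then have "0 \<le> r\<^sup>2 * (q y + c * b y)" using at by simp
      then show ?thesis
        unfolding form ry(3) qscale bscale by (simp add: algebra_simps)
    qed simp
  next
    show "\<exists>x\<in>S. x \<noteq> 0 \<and> x \<bullet> ((A + c *\<^sub>R B) *v x) \<le> a * c * (x \<bullet> x)"
      using c unfolding form by (intro bexI[of _ x]) (auto simp: K_def)
  qed (rule c_pos)
qed

subsection \<open>Graph Laplacians\<close>

lemma connected_graph_no_loop:
  assumes "connected_graph E" shows "{i} \<notin> E"
  using assms unfolding connected_graph_def by (metis doubleton_eq_iff insert_absorb2)

lemma laplacian_commute: "laplacian E $ i $ j = laplacian E $ j $ i"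
  by (auto simp: laplacian_def insert_commute)

lemma laplacian_mult_nth:
  assumes "connected_graph E"
  shows "(laplacian E *v x) $ i = (\<Sum>j\<in>UNIV. if {i, j} \<in> E then x $ i - x $ j else 0)"
proof -
  \<comment> \<open>\<open>laplacian\<close> takes the degree as the number of edges through
    \<open>i\<close>; each of them is \<open>{i, j}\<close> for a unique \<open>j\<close>, so
    neighbours can be counted instead.\<close>
  have "{e \<in> E. i \<in> e} = (\<lambda>j. {i, j}) ` {j. {i, j} \<in> E}"
  proof (intro equalityI subsetI)
    fix e assume e: "e \<in> {e \<in> E. i \<in> e}"
    have "\<forall>e\<in>E. \<exists>u v. u \<noteq> v \<and> e = {u, v}"
      using assms unfolding connected_graph_def by (rule conjunct1)
    with e obtain u v where "e = {u, v}" by auto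
    then show "e \<in> (\<lambda>j. {i, j}) ` {j. {i, j} \<in> E}" using e by (auto simp: insert_commute)
  qed auto
  moreover have "inj_on (\<lambda>j. {i, j}) {j. {i, j} \<in> E}"
    by (auto simp: inj_on_def doubleton_eq_iff)
  ultimately have deg: "card {e \<in> E. i \<in> e} = card {j. {i, j} \<in> E}"
    by (simp add: card_image)
  have "(laplacian E *v x) $ i = (\<Sum>j\<in>UNIV. (if j = i then real (card {j. {i, j} \<in> E}) * x $ i else 0)
      - (if {i, j} \<in> E then x $ j else 0))"
    unfolding matrix_vector_mult_def laplacian_def deg[symmetric]
    using connected_graph_no_loop[OF assms, of i] by (auto intro!: sum.cong)
  also have "\<dots> = real (card {j. {i, j} \<in> E}) * x $ i - (\<Sum>j\<in>UNIV. if {i, j} \<in> E then x $ j else 0)"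
    by (simp add: sum_subtractf)
  also have "real (card {j. {i, j} \<in> E}) * x $ i = (\<Sum>j\<in>UNIV. if {i, j} \<in> E then x $ i else 0)"
    by (simp add: sum.If_cases)
  finally show ?thesis by (simp add: sum_subtractf[symmetric] if_distrib cong: if_cong)
qed

lemma laplacian_mult_one: "connected_graph E \<Longrightarrow> laplacian E *v (r *\<^sub>R 1) = 0"
  by (auto simp: vec_eq_iff laplacian_mult_nth intro!: sum.neutral)

text \<open>Adding the double sum for the form to its copy with \<open>i\<close> and
  \<open>j\<close> exchanged turns the summands into squares. The factor 2 reflects that ordered
  pairs count each edge twice.\<close>

lemma laplacian_form:
  assumes "connected_graph E"
  shows "2 * (x \<bullet> (laplacian E *v x)) =
    (\<Sum>i\<in>UNIV. \<Sum>j\<in>UNIV. if {i, j} \<in> E then (x $ i - x $ j)\<^sup>2 else 0)"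
proof -
  have 1: "x \<bullet> (laplacian E *v x) =
      (\<Sum>i\<in>UNIV. \<Sum>j\<in>UNIV. if {i, j} \<in> E then x $ i * (x $ i - x $ j) else 0)"
    by (auto simp: inner_vec_def laplacian_mult_nth[OF assms] sum_distrib_left intro!: sum.cong)
  also have "\<dots> = (\<Sum>i\<in>UNIV. \<Sum>j\<in>UNIV. if {i, j} \<in> E then x $ j * (x $ j - x $ i) else 0)"
    by (subst sum.swap) (simp add: insert_commute)
  finally have 2: "x \<bullet> (laplacian E *v x) = \<dots>" .
  have "2 * (x \<bullet> (laplacian E *v x)) = x \<bullet> (laplacian E *v x) + x \<bullet> (laplacian E *v x)" by simp
  also have "\<dots> = (\<Sum>i\<in>UNIV. \<Sum>j\<in>UNIV. if {i, j} \<in> E then (x $ i - x $ j)\<^sup>2 else 0)"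
    unfolding sum.distrib[symmetric]
    by (subst 1, subst 2, unfold sum.distrib[symmetric])
      (auto simp: power2_eq_square algebra_simps intro!: sum.cong)
  finally show ?thesis .
qed

lemma laplacian_form_nonneg: "connected_graph E \<Longrightarrow> 0 \<le> x \<bullet> (laplacian E *v x)"
  using laplacian_form[of E x] by (smt (verit, best) sum_nonneg zero_le_power2)

text \<open>All squares in \<open>laplacian_form\<close> vanish, so \<open>x\<close> is constant
  along edges and, by connectedness, everywhere; the zero sum forces that constant to be 0.\<close>

lemma laplacian_form_eq_0:
  fixes x :: "real^'a"
  assumes "connected_graph E" "x \<bullet> (laplacian E *v x) = 0"
    and "(\<Sum>i\<in>UNIV. x $ i) = 0"
  shows "x = 0"
proof -
  have "(\<Sum>i\<in>UNIV. \<Sum>j\<in>UNIV. if {i, j} \<in> E then (x $ i - x $ j)\<^sup>2 else 0) = 0"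
    using laplacian_form[OF assms(1), of x] assms(2) by simp
  then have "(if {i, j} \<in> E then (x $ i - x $ j)\<^sup>2 else 0) = 0" for i j
    by (simp add: sum_nonneg_eq_0_iff sum_nonneg)
  then have step: "x $ i = x $ j" if "{i, j} \<in> E" for i j
    using that by (metis eq_iff_diff_eq_0 zero_eq_power2)
  have const: "x $ i = x $ j" for i j
  proof -
    have "(i, j) \<in> {(x, y). {x, y} \<in> E}\<^sup>*"
      using assms(1) by (simp add: connected_graph_def)
    then show "x $ i = x $ j" by (induction rule: rtrancl_induct) (auto dest: step)
  qed
  have "x $ i = 0" for i
  proof -
    have "(\<Sum>j\<in>UNIV. x $ j) = (\<Sum>j\<in>(UNIV :: 'a set). x $ i)" by (intro sum.cong refl const)
    then show ?thesis using assms(3) by simp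
  qed
  then show ?thesis by (simp add: vec_eq_iff)
qed

subsection \<open>The supra-Laplacian\<close>

definition vec_join :: "real^'a::finite \<Rightarrow> real^'b::finite \<Rightarrow> real^('a + 'b)" where
  "vec_join x y = (\<chi> p. case p of Inl i \<Rightarrow> x $ i | Inr j \<Rightarrow> y $ j)"

lemma vec_join_nth [simp]: "vec_join x y $ Inl i = x $ i" "vec_join x y $ Inr j = y $ j"
  by (simp_all add: vec_join_def)

lemma vec_sum_eq_iff:
  fixes z w :: "'c^('a::finite + 'b::finite)"
  shows "z = w \<longleftrightarrow> (\<forall>i. z $ Inl i = w $ Inl i) \<and> (\<forall>j. z $ Inr j = w $ Inr j)"
  by (metis sumE vec_eq_iff)

lemma vec_join_cases: obtains x y where "z = vec_join x y"
  using that[of "\<chi> i. z $ Inl i" "\<chi> j. z $ Inr j"] by (simp add: vec_sum_eq_iff)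

lemma sum_UNIV_Plus:
  fixes f :: "'a::finite + 'b::finite \<Rightarrow> real"
  shows "(\<Sum>p\<in>UNIV. f p) = (\<Sum>i\<in>UNIV. f (Inl i)) + (\<Sum>j\<in>UNIV. f (Inr j))"
  by (simp add: sum.Plus flip: UNIV_Plus_UNIV)

lemma inner_vec_join [simp]: "vec_join x y \<bullet> vec_join x' y' = x \<bullet> x' + y \<bullet> y'"
  by (simp add: inner_vec_def sum_UNIV_Plus)

lemma vec_join_eq_0_iff [simp]: "vec_join x y = 0 \<longleftrightarrow> x = 0 \<and> y = 0"
  by (auto simp: vec_sum_eq_iff vec_eq_iff)

lemma inner_one_eq_sum: "(1 :: real^'a) \<bullet> x = (\<Sum>i\<in>UNIV. x $ i)"
  by (simp add: inner_vec_def)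

lemma transpose_supra_laplacian:
  "transpose (supra_laplacian E\<^sub>1 E\<^sub>2 W) = supra_laplacian E\<^sub>1 E\<^sub>2 W"
  by (auto simp: vec_sum_eq_iff transpose_def supra_laplacian_def diag_def
      intro: laplacian_commute)

text \<open>The supra-Laplacian is affine in the weights, which brings \<open>c *\<^sub>R W\<close>
  into the shape of \<open>form_pencil_first_crossing\<close>.\<close>

lemma supra_laplacian_scaleR:
  "supra_laplacian E\<^sub>1 E\<^sub>2 (c *\<^sub>R W) = supra_laplacian E\<^sub>1 E\<^sub>2 0
    + c *\<^sub>R (supra_laplacian E\<^sub>1 E\<^sub>2 W - supra_laplacian E\<^sub>1 E\<^sub>2 0)"
  by (auto simp: vec_sum_eq_iff transpose_def supra_laplacian_def diag_def
      matrix_vector_mult_def sum_distrib_left)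

lemma supra_laplacian_mult_Inl:
  "(supra_laplacian E\<^sub>1 E\<^sub>2 W *v vec_join x y) $ Inl i
    = (laplacian E\<^sub>1 *v x) $ i + (\<Sum>j\<in>UNIV. W $ i $ j * (x $ i - y $ j))"
  by (simp add: supra_laplacian_def matrix_vector_mult_def sum_UNIV_Plus diag_def
      distrib_right sum.distrib if_distrib[of "\<lambda>a. a * _"] right_diff_distrib sum_subtractf
      sum_negf sum_distrib_right cong: if_cong)

lemma supra_laplacian_mult_Inr:
  "(supra_laplacian E\<^sub>1 E\<^sub>2 W *v vec_join x y) $ Inr j
    = (laplacian E\<^sub>2 *v y) $ j + (\<Sum>i\<in>UNIV. W $ i $ j * (y $ j - x $ i))"
  by (simp add: supra_laplacian_def matrix_vector_mult_def sum_UNIV_Plus diag_def transpose_def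
      distrib_right sum.distrib if_distrib[of "\<lambda>a. a * _"] right_diff_distrib sum_subtractf
      sum_negf sum_distrib_right cong: if_cong)

lemma supra_laplacian_form:
  "vec_join x y \<bullet> (supra_laplacian E\<^sub>1 E\<^sub>2 W *v vec_join x y)
    = x \<bullet> (laplacian E\<^sub>1 *v x) + y \<bullet> (laplacian E\<^sub>2 *v y)
      + (\<Sum>i\<in>UNIV. \<Sum>j\<in>UNIV. W $ i $ j * (x $ i - y $ j)\<^sup>2)"
proof -
  have "(\<Sum>j\<in>UNIV. \<Sum>i\<in>UNIV. y $ j * (W $ i $ j * (y $ j - x $ i)))
      = (\<Sum>i\<in>UNIV. \<Sum>j\<in>UNIV. y $ j * (W $ i $ j * (y $ j - x $ i)))"
    by (rule sum.swap)
  moreover have "(\<Sum>i\<in>UNIV. \<Sum>j\<in>UNIV. W $ i $ j * (x $ i - y $ j)\<^sup>2)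
      = (\<Sum>i\<in>UNIV. \<Sum>j\<in>UNIV. x $ i * (W $ i $ j * (x $ i - y $ j)))
      + (\<Sum>i\<in>UNIV. \<Sum>j\<in>UNIV. y $ j * (W $ i $ j * (y $ j - x $ i)))"
    unfolding sum.distrib[symmetric]
    by (intro sum.cong) (auto simp: power2_eq_square algebra_simps)
  ultimately show ?thesis
    unfolding inner_vec_def[of "vec_join x y"] sum_UNIV_Plus supra_laplacian_mult_Inl
      supra_laplacian_mult_Inr
    by (simp add: inner_vec_def distrib_left sum.distrib sum_distrib_left)
qed

text \<open>A Fiedler vector is an eigenvector for the algebraic connectivity, which this one is for
  scaled regular weights up to the threshold.\<close>

definition fiedler_vec :: "real^('a::finite + 'b::finite)" where
  "fiedler_vec = (\<chi> p. case p of Inl i \<Rightarrow> real CARD('b) | Inr j \<Rightarrow> - real CARD('a))"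

lemma fiedler_vec_eq:
  "(fiedler_vec :: real^('a::finite + 'b::finite)) =
    vec_join (real CARD('b) *\<^sub>R 1) ((- real CARD('a)) *\<^sub>R 1)"
  by (simp add: vec_sum_eq_iff fiedler_vec_def)

lemma inner_fiedler_vec:
  "(fiedler_vec :: real^('a::finite + 'b::finite)) \<bullet> fiedler_vec
    = real CARD('a) * real CARD('b) * (real CARD('a) + real CARD('b))"
  by (simp add: fiedler_vec_eq inner_one_eq_sum algebra_simps)

lemma fiedler_vec_nonzero: "(fiedler_vec :: real^('a::finite + 'b::finite)) \<noteq> 0"
proof -
  have "fiedler_vec $ Inr undefined \<noteq> (0 :: real^('a + 'b)) $ Inr undefined"
    by (simp add: fiedler_vec_def)
  then show ?thesis by metis
qed

lemma vec_join_one_eq: "(1 :: real^('a::finite + 'b::finite)) = vec_join 1 1"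
  by (simp add: vec_sum_eq_iff)

lemma one_orthogonal_fiedler_vec: "1 \<bullet> (fiedler_vec :: real^('a::finite + 'b::finite)) = 0"
  by (simp add: fiedler_vec_eq vec_join_one_eq inner_one_eq_sum)

text \<open>For the layer sums \<open>s\<close> and \<open>t\<close> the two conditions read
  \<open>s + t = 0\<close> and \<open>m * s = n * t\<close>, which only zero solves. This yields the
  zero sum on each layer that \<open>laplacian_form_eq_0\<close> requires.\<close>

lemma orthogonal_one_fiedler_vec_iff:
  fixes x :: "real^'a" and y :: "real^'b"
  shows "1 \<bullet> vec_join x y = 0 \<and> fiedler_vec \<bullet> vec_join x y = 0
    \<longleftrightarrow> (\<Sum>i\<in>UNIV. x $ i) = 0 \<and> (\<Sum>j\<in>UNIV. y $ j) = 0"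
proof -
  have "m * s = n * t \<and> s + t = 0 \<longleftrightarrow> s = 0 \<and> t = 0" if "m > 0" "n > 0" for m n s t :: real
  proof
    assume st: "m * s = n * t \<and> s + t = 0"
    then have "t = - s" by simp
    with st have "(m + n) * s = 0" by (simp add: distrib_right)
    with that \<open>t = - s\<close> show "s = 0 \<and> t = 0" by simp
  qed simp
  from this[of "real CARD('b)" "real CARD('a)"] show ?thesis
    by (auto simp: vec_join_one_eq fiedler_vec_eq inner_one_eq_sum)
qed

lemma supra_laplacian_mult_one:
  assumes "connected_graph E\<^sub>1" "connected_graph E\<^sub>2"
  shows "supra_laplacian E\<^sub>1 E\<^sub>2 W *v 1 = 0"
  using laplacian_mult_one[OF assms(1), of 1] laplacian_mult_one[OF assms(2), of 1]
  by (simp add: vec_sum_eq_iff vec_join_one_eq supra_laplacian_mult_Inl supra_laplacian_mult_Inr)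

text \<open>Each layer Laplacian kills the constant on its layer, and across a link the vector jumps
  by m - (-n) = n + m, so only the row and column sums of \<open>W\<close> remain.\<close>

lemma supra_laplacian_mult_fiedler_vec:
  fixes W :: "real^'b^'a"
  assumes "connected_graph E\<^sub>1" "connected_graph E\<^sub>2"
  shows "supra_laplacian E\<^sub>1 E\<^sub>2 W *v fiedler_vec = (real CARD('a) + real CARD('b)) *\<^sub>R
    vec_join (W *v 1) (- (transpose W *v 1))"
  unfolding fiedler_vec_eq vec_sum_eq_iff supra_laplacian_mult_Inl supra_laplacian_mult_Inr
    laplacian_mult_one[OF assms(1)] laplacian_mult_one[OF assms(2)]
  by (simp add: matrix_vector_mult_def transpose_def sum_distrib_right[symmetric] mult.commute
      sum_negf algebra_simps sum.distrib sum_subtractf sum_distrib_left)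

section \<open>Total weight and regularity\<close>

lemma link_weights_total:
  fixes W :: "real^'b^'a"
  assumes "W \<in> link_weights E c"
  shows "(\<Sum>i\<in>UNIV. \<Sum>j\<in>UNIV. W $ i $ j) = c"
proof -
  have "(\<Sum>(i, j)\<in>E. W $ i $ j) = (\<Sum>(i, j)\<in>UNIV \<times> UNIV. W $ i $ j)"
    using assms by (intro sum.mono_neutral_left) (auto simp: link_weights_def)
  then show ?thesis using assms by (simp add: sum.cartesian_product link_weights_def)
qed

lemma scaleR_mem_link_weights:
  assumes "W \<in> link_weights E 1" "0 \<le> c"
  shows "c *\<^sub>R W \<in> link_weights E c"
  using assms by (simp add: link_weights_def case_prod_unfold flip: sum_distrib_left)

text \<open>Only the links contribute, each its weight times the square of n + m, so the value
  depends on the total \<open>c\<close> alone. The squared norm n m (n + m) accounts for the factor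
  1/n + 1/m.\<close>

lemma supra_laplacian_form_fiedler_vec:
  fixes W :: "real^'b^'a"
  assumes "connected_graph E\<^sub>1" "connected_graph E\<^sub>2" "W \<in> link_weights E\<^sub>3 c"
  shows "fiedler_vec \<bullet> (supra_laplacian E\<^sub>1 E\<^sub>2 W *v fiedler_vec)
    = (1 / real CARD('a) + 1 / real CARD('b)) * c * (fiedler_vec \<bullet> (fiedler_vec :: real^('a + 'b)))"
proof -
  have "fiedler_vec \<bullet> (supra_laplacian E\<^sub>1 E\<^sub>2 W *v fiedler_vec)
      = (\<Sum>i\<in>UNIV. \<Sum>j\<in>UNIV. W $ i $ j) * (real CARD('b) + real CARD('a))\<^sup>2"
    unfolding fiedler_vec_eq supra_laplacian_form laplacian_mult_one[OF assms(1)]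
      laplacian_mult_one[OF assms(2)]
    by (simp add: sum_distrib_right)
  also have "\<dots> = c * (real CARD('b) + real CARD('a))\<^sup>2"
    by (simp add: link_weights_total[OF assms(3)])
  finally show ?thesis
    unfolding inner_fiedler_vec by (simp add: power2_eq_square field_simps)
qed

lemma mem_span_one_iff: "x \<in> span {1 :: real^'a} \<longleftrightarrow> (\<exists>r. \<forall>i. x $ i = r)"
  unfolding span_singleton by (auto simp: vec_eq_iff image_iff)

lemma regular_row_col_sums:
  fixes W :: "real^'b^'a"
  assumes "regular W" "(\<Sum>i\<in>UNIV. \<Sum>j\<in>UNIV. W $ i $ j) = c"
  shows "(\<Sum>j\<in>UNIV. W $ i $ j) = c / real CARD('a)" "(\<Sum>i\<in>UNIV. W $ i $ j) = c / real CARD('b)"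
proof -
  obtain r where r: "\<And>i. (\<Sum>j\<in>UNIV. W $ i $ j) = r"
    using assms(1) by (auto simp: regular_def mem_span_one_iff matrix_vector_mult_def)
  obtain s where s: "\<And>j. (\<Sum>i\<in>UNIV. W $ i $ j) = s"
    using assms(1) by (auto simp: regular_def mem_span_one_iff matrix_vector_mult_def transpose_def)
  have "real CARD('a) * r = c" using assms(2) by (simp add: r)
  then show "(\<Sum>j\<in>UNIV. W $ i $ j) = c / real CARD('a)" by (auto simp: r)
  have "(\<Sum>j\<in>UNIV. \<Sum>i\<in>UNIV. W $ i $ j) = c" using assms(2) by (subst sum.swap)
  then have "real CARD('b) * s = c" by (simp add: s)
  then show "(\<Sum>i\<in>UNIV. W $ i $ j) = c / real CARD('b)" by (auto simp: s)
qed

lemma regular_imp_fiedler_eigenvector: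
  fixes W :: "real^'b^'a"
  assumes "connected_graph E\<^sub>1" "connected_graph E\<^sub>2"
    and "regular W" "(\<Sum>i\<in>UNIV. \<Sum>j\<in>UNIV. W $ i $ j) = c"
  shows "supra_laplacian E\<^sub>1 E\<^sub>2 W *v fiedler_vec
    = ((1 / real CARD('a) + 1 / real CARD('b)) * c) *\<^sub>R fiedler_vec"
  unfolding supra_laplacian_mult_fiedler_vec[OF assms(1,2)] unfolding fiedler_vec_eq
  using regular_row_col_sums[OF assms(3,4)]
  by (simp add: vec_sum_eq_iff matrix_vector_mult_def transpose_def field_simps)

lemma fiedler_eigenvector_imp_regular:
  fixes W :: "real^'b^'a"
  assumes "connected_graph E\<^sub>1" "connected_graph E\<^sub>2"
    and "supra_laplacian E\<^sub>1 E\<^sub>2 W *v fiedler_vec = a *\<^sub>R fiedler_vec"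
  shows "regular W"
proof -
  let ?N = "real CARD('a) + real CARD('b)"
  have N: "?N > 0" by (simp add: add_pos_pos)
  have *: "?N *\<^sub>R vec_join (W *v 1) (- (transpose W *v 1)) = a *\<^sub>R fiedler_vec"
    using assms(3) unfolding supra_laplacian_mult_fiedler_vec[OF assms(1,2)] .
  have "(W *v 1) $ i = a * real CARD('b) / ?N" for i
    using arg_cong[OF *, of "\<lambda>z. z $ Inl i"] N by (simp add: fiedler_vec_eq field_simps)
  moreover have "(transpose W *v 1) $ j = a * real CARD('a) / ?N" for j
    using arg_cong[OF *, of "\<lambda>z. z $ Inr j"] N by (simp add: fiedler_vec_eq field_simps)
  ultimately show ?thesis unfolding regular_def mem_span_one_iff by blast
qed

text \<open>Without links the form is the sum of the two layer forms, each of which is positive on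
  nonzero vectors of zero sum.\<close>

lemma layers_form_pos:
  fixes z :: "real^('a::finite + 'b::finite)"
  assumes "connected_graph E\<^sub>1" "connected_graph E\<^sub>2"
    and "1 \<bullet> z = 0" "fiedler_vec \<bullet> z = 0" "z \<noteq> 0"
  shows "0 < z \<bullet> (supra_laplacian E\<^sub>1 E\<^sub>2 0 *v z)"
proof -
  obtain x y where z: "z = vec_join x y" by (rule vec_join_cases)
  have sums: "(\<Sum>i\<in>UNIV. x $ i) = 0" "(\<Sum>j\<in>UNIV. y $ j) = 0"
    using assms(3,4) orthogonal_one_fiedler_vec_iff[of x y] by (auto simp: z)
  have "z \<bullet> (supra_laplacian E\<^sub>1 E\<^sub>2 0 *v z) = x \<bullet> (laplacian E\<^sub>1 *v x) + y \<bullet> (laplacian E\<^sub>2 *v y)"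
    unfolding z supra_laplacian_form by simp
  then show ?thesis
    using laplacian_form_eq_0[OF assms(1) _ sums(1)] laplacian_form_eq_0[OF assms(2) _ sums(2)]
      laplacian_form_nonneg[OF assms(1), of x] laplacian_form_nonneg[OF assms(2), of y]
      assms(5) unfolding z vec_join_eq_0_iff by linarith
qed

subsection \<open>The transition threshold\<close>

lemma exists_nonzero_sum_zero:
  assumes "2 \<le> CARD('a)"
  shows "\<exists>x :: real^'a. x \<noteq> 0 \<and> (\<Sum>i\<in>UNIV. x $ i) = 0"
proof -
  obtain i j :: 'a where "i \<noteq> j"
    using assms card_le_Suc0_iff_eq[of "UNIV :: 'a set"] by fastforce
  then have "axis i 1 - axis j (1 :: real) \<noteq> 0" by (simp add: axis_eq_axis)
  moreover have "(\<Sum>k\<in>UNIV. (axis i 1 - axis j (1 :: real)) $ k) = 0"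
    by (simp add: sum_subtractf axis_def)
  ultimately show ?thesis by blast
qed

text \<open>A vector supported on one layer and orthogonal to the constants sees the interlayer links only
  through the constant row (or column) sum \<open>1/n\<close> (or \<open>1/m\<close>), which is less than
  \<open>1/n + 1/m\<close>; so the line \<open>(1/n + 1/m) c\<close> overtakes some other eigenvalue eventually.\<close>

lemma exists_slow_direction:
  fixes W :: "real^'b^'a"
  assumes "3 \<le> CARD('a) + CARD('b)" "regular W" "(\<Sum>i\<in>UNIV. \<Sum>j\<in>UNIV. W $ i $ j) = 1"
  shows "\<exists>z :: real^('a + 'b). 1 \<bullet> z = 0 \<and> fiedler_vec \<bullet> z = 0 \<and>
    z \<bullet> ((supra_laplacian E\<^sub>1 E\<^sub>2 W - supra_laplacian E\<^sub>1 E\<^sub>2 0) *v z)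
      < (1 / real CARD('a) + 1 / real CARD('b)) * (z \<bullet> z)"
proof -
  have form: "vec_join x y \<bullet> ((supra_laplacian E\<^sub>1 E\<^sub>2 W - supra_laplacian E\<^sub>1 E\<^sub>2 0) *v vec_join x y)
      = (\<Sum>i\<in>UNIV. \<Sum>j\<in>UNIV. W $ i $ j * (x $ i - y $ j)\<^sup>2)" for x y
    by (simp add: matrix_vector_mult_diff_rdistrib inner_diff_right supra_laplacian_form)
  show ?thesis
  \<comment> \<open>A nonzero vector of zero sum requires a layer with at least two vertices, which
    n + m \<ge> 3 provides.\<close>
  proof (cases "2 \<le> CARD('a)")
    case True
    obtain x :: "real^'a" where x: "x \<noteq> 0" "(\<Sum>i\<in>UNIV. x $ i) = 0"
      using exists_nonzero_sum_zero[OF True] by blast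
    have "(\<Sum>i\<in>UNIV. \<Sum>j\<in>UNIV. W $ i $ j * (x $ i)\<^sup>2) = 1 / real CARD('a) * (x \<bullet> x)"
      unfolding sum_distrib_right[symmetric] regular_row_col_sums(1)[OF assms(2,3)]
      by (simp add: inner_vec_def sum_distrib_left power2_eq_square sum_divide_distrib)
    also have "\<dots> < (1 / real CARD('a) + 1 / real CARD('b)) * (x \<bullet> x)"
      using x(1) by (intro mult_strict_right_mono) auto
    finally show ?thesis
      using x(2) orthogonal_one_fiedler_vec_iff[of x "0 :: real^'b"]
      by (intro exI[of _ "vec_join x 0"]) (simp add: form)
  next
    case False
    then have "2 \<le> CARD('b)" using assms(1) by linarith
    then obtain y :: "real^'b" where y: "y \<noteq> 0" "(\<Sum>j\<in>UNIV. y $ j) = 0"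
      using exists_nonzero_sum_zero by blast
    have "(\<Sum>i\<in>UNIV. \<Sum>j\<in>UNIV. W $ i $ j * (y $ j)\<^sup>2)
        = (\<Sum>j\<in>UNIV. \<Sum>i\<in>UNIV. W $ i $ j * (y $ j)\<^sup>2)"
      by (rule sum.swap)
    also have "\<dots> = 1 / real CARD('b) * (y \<bullet> y)"
      unfolding sum_distrib_right[symmetric]
        regular_row_col_sums(2)[OF assms(2,3)]
      by (simp add: inner_vec_def sum_distrib_left power2_eq_square sum_divide_distrib)
    also have "\<dots> < (1 / real CARD('a) + 1 / real CARD('b)) * (y \<bullet> y)"
      using y(1) by (intro mult_strict_right_mono) auto
    finally show ?thesis
      using y(2) orthogonal_one_fiedler_vec_iff[of "0 :: real^'a" y]
      by (intro exI[of _ "vec_join 0 y"]) (simp add: form)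
  qed
qed

section \<open>The bound on the algebraic connectivity, its equality case, and attainment up to the
  threshold\<close>

lemma algebraic_connectivity_le:
  fixes W :: "real^'b::finite^'a::finite"
  assumes "connected_graph E\<^sub>1" "connected_graph E\<^sub>2" "W \<in> link_weights E\<^sub>3 c" "0 \<le> c"
  shows "algebraic_connectivity E\<^sub>1 E\<^sub>2 W \<le> (1 / real CARD('a) + 1 / real CARD('b)) * c"
  unfolding algebraic_connectivity_def
  by (rule second_eigenvalue_le[OF transpose_supra_laplacian _ supra_laplacian_mult_one
        fiedler_vec_nonzero one_orthogonal_fiedler_vec])
    (use assms supra_laplacian_form_fiedler_vec[OF assms(1-3)] in \<open>auto simp: vec_join_one_eq\<close>)

lemma algebraic_connectivity_eq_imp_regular:
  fixes W :: "real^'b::finite^'a::finite"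
  assumes "connected_graph E\<^sub>1" "connected_graph E\<^sub>2" "W \<in> link_weights E\<^sub>3 c" "0 \<le> c"
    and "algebraic_connectivity E\<^sub>1 E\<^sub>2 W = (1 / real CARD('a) + 1 / real CARD('b)) * c"
  shows "regular W"
\<comment> \<open>\<open>second_eigenvalue_eq_imp_eigenvector\<close> asks for a positive
  eigenvalue, so \<open>c = 0\<close> is treated apart: there all weights vanish.\<close>
proof (cases "c = 0")
  case True
  have "\<forall>i j. 0 \<le> W $ i $ j" using assms(3) by (simp add: link_weights_def)
  then have "\<forall>i j. W $ i $ j = 0"
    using link_weights_total[OF assms(3)] True by (simp add: sum_nonneg_eq_0_iff sum_nonneg)
  then have "W = 0" by (simp add: vec_eq_iff)
  then show ?thesis by (auto simp: regular_def mem_span_one_iff matrix_vector_mult_def transpose_def)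
next
  case False
  have "supra_laplacian E\<^sub>1 E\<^sub>2 W *v fiedler_vec
    = ((1 / real CARD('a) + 1 / real CARD('b)) * c) *\<^sub>R fiedler_vec"
    using assms False
    by (intro second_eigenvalue_eq_imp_eigenvector[OF transpose_supra_laplacian, of 1]
        supra_laplacian_mult_one fiedler_vec_nonzero one_orthogonal_fiedler_vec
        supra_laplacian_form_fiedler_vec)
      (auto simp: vec_join_one_eq algebraic_connectivity_def add_pos_pos)
  then show ?thesis by (rule fiedler_eigenvector_imp_regular[OF assms(1,2)])
qed

lemma algebraic_connectivity_upto_threshold:
  fixes W :: "real^'b::finite^'a::finite"
  assumes "connected_graph E\<^sub>1" "connected_graph E\<^sub>2" "3 \<le> CARD('a) + CARD('b)"
    and "W \<in> link_weights E\<^sub>3 1" "regular W"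
    and "0 \<le> c" "c \<le> transition_threshold E\<^sub>1 E\<^sub>2 W"
  shows "algebraic_connectivity E\<^sub>1 E\<^sub>2 (c *\<^sub>R W) = (1 / real CARD('a) + 1 / real CARD('b)) * c"
proof -
  define \<alpha> where "\<alpha> = 1 / real CARD('a) + 1 / real CARD('b)"
  have \<alpha>: "\<alpha> > 0" by (simp add: \<alpha>_def add_pos_pos)
  define A where "A = supra_laplacian E\<^sub>1 E\<^sub>2 (0 :: real^'b^'a)"
  define B where "B = supra_laplacian E\<^sub>1 E\<^sub>2 W - A"
  define L where "L t = supra_laplacian E\<^sub>1 E\<^sub>2 (t *\<^sub>R W)" for t
  have L: "L t = A + t *\<^sub>R B" for t
    unfolding L_def A_def B_def by (rule supra_laplacian_scaleR)
  define S where "S = {z :: real^('a + 'b). 1 \<bullet> z = 0} \<inter> {z. fiedler_vec \<bullet> z = 0}"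
  have S: "subspace S"
    unfolding S_def by (intro subspace_inter subspace_hyperplane)
  have total: "(\<Sum>i\<in>UNIV. \<Sum>j\<in>UNIV. W $ i $ j) = 1"
    by (rule link_weights_total[OF assms(4)])
  obtain z where z: "z \<in> S" "z \<bullet> (B *v z) < \<alpha> * (z \<bullet> z)"
    using exists_slow_direction[OF assms(3,5) total, of E\<^sub>1 E\<^sub>2]
    by (auto simp: S_def A_def B_def \<alpha>_def)
  have "0 < z \<bullet> (A *v z)" if "z \<in> S" "z \<noteq> 0" for z
    using layers_form_pos[OF assms(1,2)] that by (simp add: S_def A_def)
  from form_pencil_first_crossing[OF S this z] obtain c\<^sub>0 where c\<^sub>0: "0 < c\<^sub>0"
    and below: "\<And>t x. 0 \<le> t \<Longrightarrow> t < c\<^sub>0 \<Longrightarrow> x \<in> S \<Longrightarrow> x \<noteq> 0 \<Longrightarrow> \<alpha> * t * (x \<bullet> x) < x \<bullet> (L t *v x)"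
    and at: "\<And>x. x \<in> S \<Longrightarrow> \<alpha> * c\<^sub>0 * (x \<bullet> x) \<le> x \<bullet> (L c\<^sub>0 *v x)"
    and cross: "\<exists>x\<in>S. x \<noteq> 0 \<and> x \<bullet> (L c\<^sub>0 *v x) \<le> \<alpha> * c\<^sub>0 * (x \<bullet> x)"
    unfolding L by metis
  have sym: "transpose (L t) = L t" for t
    unfolding L_def by (rule transpose_supra_laplacian)
  have one: "L t *v 1 = 0" for t
    unfolding L_def by (rule supra_laplacian_mult_one[OF assms(1,2)])
  have one_nz: "(1 :: real^('a + 'b)) \<noteq> 0" by (simp add: vec_join_one_eq)
  have eig: "L t *v fiedler_vec = (\<alpha> * t) *\<^sub>R fiedler_vec" for t
  proof -
    \<comment> \<open>The zero matrix is regular of total weight 0, so the general eigenvalue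
      formula gives 0 for the uncoupled layers.\<close>
    have "A *v fiedler_vec = 0"
      using regular_imp_fiedler_eigenvector[OF assms(1,2), of "0 :: real^'b^'a" 0]
      by (simp add: A_def regular_def mem_span_one_iff matrix_vector_mult_def transpose_def)
    moreover have "supra_laplacian E\<^sub>1 E\<^sub>2 W *v fiedler_vec = \<alpha> *\<^sub>R fiedler_vec"
      using regular_imp_fiedler_eigenvector[OF assms(1,2,5) total] by (simp add: \<alpha>_def)
    ultimately show ?thesis
      unfolding L B_def
      by (simp add: matrix_vector_mult_add_rdistrib matrix_vector_mult_diff_rdistrib
          scaleR_matrix_vector_assoc[symmetric] mult.commute)
  qed
  \<comment> \<open>The endpoint is included because the claim extends to the threshold itself;
    there the weak inequality \<open>at\<close> takes the place of \<open>below\<close>.\<close>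
  have second: "nth_eigenvalue 2 (L t) = \<alpha> * t" if "0 \<le> t" "t \<le> c\<^sub>0" for t
  proof (rule second_eigenvalue_eqI[OF sym one_nz one fiedler_vec_nonzero eig
        one_orthogonal_fiedler_vec])
    show "0 \<le> \<alpha> * t" using that \<alpha> by simp
    show "2 \<le> CARD('a + 'b)" using assms(3) by simp
    fix x :: "real^('a + 'b)" assume "1 \<bullet> x = 0" "fiedler_vec \<bullet> x = 0"
    then have "x \<in> S" by (simp add: S_def)
    then show "\<alpha> * t * (x \<bullet> x) \<le> x \<bullet> (L t *v x)"
      using at[of x] below[of t x] that by (cases "t = c\<^sub>0"; cases "x = 0") auto
  qed
  have "transition_threshold E\<^sub>1 E\<^sub>2 W = c\<^sub>0"
    unfolding transition_threshold_def L_def[symmetric]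
  \<comment> \<open>\<open>LEAST\<close> over the reals denotes a minimum only if one is attained;
    \<open>c\<^sub>0\<close> is shown to be that minimum.\<close>
  proof (rule Least_equality)
    \<comment> \<open>The crossing vector pushes the third eigenvalue down to \<alpha>
      \<open>c\<^sub>0\<close>, which is the value of the second.\<close>
    obtain x where x: "x \<in> S" "x \<noteq> 0" "x \<bullet> (L c\<^sub>0 *v x) \<le> \<alpha> * c\<^sub>0 * (x \<bullet> x)" using cross by blast
    then have "nth_eigenvalue 3 (L c\<^sub>0) \<le> \<alpha> * c\<^sub>0"
      using c\<^sub>0 \<alpha> by (intro third_eigenvalue_le[OF sym one_nz one fiedler_vec_nonzero eig
            one_orthogonal_fiedler_vec]) (auto simp: S_def)
    moreover have "nth_eigenvalue 2 (L c\<^sub>0) \<le> nth_eigenvalue 3 (L c\<^sub>0)"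
      using assms(3) by (intro nth_eigenvalue_mono sym) auto
    ultimately show "0 < c\<^sub>0 \<and> nth_eigenvalue 2 (L c\<^sub>0) = nth_eigenvalue 3 (L c\<^sub>0)"
      using second[of c\<^sub>0] c\<^sub>0 by simp
  next
    fix t assume t: "0 < t \<and> nth_eigenvalue 2 (L t) = nth_eigenvalue 3 (L t)"
    show "c\<^sub>0 \<le> t"
    proof (rule ccontr)
      assume "\<not> c\<^sub>0 \<le> t"
      \<comment> \<open>Before the crossing the form exceeds the line strictly on \<open>S\<close>,
        which keeps the third eigenvalue apart from the second.\<close>
      then have "\<alpha> * t < nth_eigenvalue 3 (L t)"
        using t below assms(3)
        by (intro third_eigenvalue_gt[OF sym one_nz one, of fiedler_vec]) (auto simp: S_def)
      with second[of t] t \<open>\<not> c\<^sub>0 \<le> t\<close> show False by simp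
    qed
  qed
  then show ?thesis
    using second[OF assms(6)] assms(7) by (simp add: algebraic_connectivity_def L_def \<alpha>_def)
qed

theorem lemma3p4:
  fixes E\<^sub>1 :: "'a::finite set set" and E\<^sub>2 :: "'b::finite set set"
    and E\<^sub>3 :: "('a \<times> 'b) set"
    and W\<^sub>0 :: "real^'b^'a" and c :: real
  assumes "connected_graph E\<^sub>1" and "connected_graph E\<^sub>2"
    and "CARD('a) + CARD('b) \<ge> 3"
    and "W\<^sub>0 \<in> link_weights E\<^sub>3 1" and "regular W\<^sub>0"
    and "0 \<le> c" and "c \<le> transition_threshold E\<^sub>1 E\<^sub>2 W\<^sub>0"
  shows "max_algebraic_connectivity E\<^sub>1 E\<^sub>2 E\<^sub>3 c = (1 / real CARD('a) + 1 / real CARD('b)) * c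
    \<and> is_arg_max (algebraic_connectivity E\<^sub>1 E\<^sub>2) (\<lambda>W. W \<in> link_weights E\<^sub>3 c) (c *\<^sub>R W\<^sub>0)
    \<and> is_eigenvector (supra_laplacian E\<^sub>1 E\<^sub>2 (c *\<^sub>R W\<^sub>0))
        (\<chi> p. case p of Inl i \<Rightarrow> real CARD('b) | Inr j \<Rightarrow> - real CARD('a))
        (max_algebraic_connectivity E\<^sub>1 E\<^sub>2 E\<^sub>3 c)
    \<and> (\<forall>W. is_arg_max (algebraic_connectivity E\<^sub>1 E\<^sub>2) (\<lambda>W. W \<in> link_weights E\<^sub>3 c) W
          \<longrightarrow> regular W)"
proof -
  have attained: "algebraic_connectivity E\<^sub>1 E\<^sub>2 (c *\<^sub>R W\<^sub>0) = (1 / real CARD('a) + 1 / real CARD('b)) * c"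
    by (rule algebraic_connectivity_upto_threshold[OF assms])
  have mem: "c *\<^sub>R W\<^sub>0 \<in> link_weights E\<^sub>3 c"
    by (rule scaleR_mem_link_weights[OF assms(4,6)])
  have le: "algebraic_connectivity E\<^sub>1 E\<^sub>2 W \<le> (1 / real CARD('a) + 1 / real CARD('b)) * c"
    if "W \<in> link_weights E\<^sub>3 c" for W
    by (rule algebraic_connectivity_le[OF assms(1,2) that assms(6)])
  have max: "max_algebraic_connectivity E\<^sub>1 E\<^sub>2 E\<^sub>3 c = (1 / real CARD('a) + 1 / real CARD('b)) * c"
    unfolding max_algebraic_connectivity_def
    using attained mem le by (intro Greatest_equality) force+
  have arg_max: "is_arg_max (algebraic_connectivity E\<^sub>1 E\<^sub>2) (\<lambda>W. W \<in> link_weights E\<^sub>3 c) (c *\<^sub>R W\<^sub>0)"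
    using attained mem le by (auto simp: is_arg_max_linorder)
  \<comment> \<open>Regularity of the scaled weights comes from the equality case, since they attain
    the bound.\<close>
  have "regular (c *\<^sub>R W\<^sub>0)"
    by (rule algebraic_connectivity_eq_imp_regular[OF assms(1,2) mem assms(6) attained])
  then have "is_eigenvector (supra_laplacian E\<^sub>1 E\<^sub>2 (c *\<^sub>R W\<^sub>0)) fiedler_vec
      (max_algebraic_connectivity E\<^sub>1 E\<^sub>2 E\<^sub>3 c)"
    unfolding is_eigenvector_def max
    using regular_imp_fiedler_eigenvector[OF assms(1,2)] link_weights_total[OF mem]
      fiedler_vec_nonzero by blast
  moreover have "regular W"
    if "is_arg_max (algebraic_connectivity E\<^sub>1 E\<^sub>2) (\<lambda>W. W \<in> link_weights E\<^sub>3 c) W" for W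
  proof (rule algebraic_connectivity_eq_imp_regular[OF assms(1,2) _ assms(6)])
    show "W \<in> link_weights E\<^sub>3 c" using that by (simp add: is_arg_max_def)
    \<comment> \<open>A maximizer does at least as well as \<open>c *\<^sub>R W\<^sub>0\<close>,
      which already attains the upper bound.\<close>
    then show "algebraic_connectivity E\<^sub>1 E\<^sub>2 W = (1 / real CARD('a) + 1 / real CARD('b)) * c"
      using that le[of W] mem attained by (fastforce simp: is_arg_max_linorder)
  qed
  ultimately show ?thesis
    using max arg_max unfolding fiedler_vec_def by blast
qed

end
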